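(* Suppose that $(\phi_t)_{t\ge0}$ and $(\widetilde{\phi}_t)_{t\ge0}$ are non-elliptic semigroups of holomorphic self-maps of the unit disk $\mathbb{D}$ with Denjoy-Wolff points $\tau,\widetilde{\tau}\in\partial\mathbb{D}$, Koenigs domains $\Omega,\widetilde{\Omega}$, and orthogonal speeds $v^o,\widetilde{v}^o$, respectively. If $\Omega\subset\widetilde{\Omega}$, then \[ \liminf_{t\to\infty}\,[v^o(t)-\widetilde{v}^o(t)]\ge -\log 2. \]
   Context: $\mathbb{D}=\{z\in\mathbb{C}:|z|<1\}$. A family $(\phi_t)_{t\ge 0}$ of holomorphic maps $\phi_t:\mathbb{D}\to\mathbb{D}$ is a semigroup if (a) $\phi_0$ is the identity; (b) $\phi_{t+s}=\phi_t\circ\phi_s$ for all $t,s\ge 0$; (c) $\lim_{t\to s}\phi_t(z)=\phi_s(z)$ for every $s\ge 0$ and $z\in\mathbb{D}$. It is non-elliptic if for every $t>0$ the map $\phi_t$ has no fixed points in $\mathbb{D}$. In that case there is a unique point $\tau\in\partial\mathbb{D}$, the Denjoy-Wolff point, such that $\lim_{t\to\infty}\phi_t(z)=\tau$ for every $z\in\mathbb{D}$. For a non-elliptic semigroup there is a unique conformal (injective holomorphic) map $h:\mathbb{D}\to\mathbb{C}$ with $h(0)=0$ and $\phi_t(z)=h^{-1}(h(z)+t)$ for all $z\in\mathbb{D}$, $t\ge0$; $h$ is the Koenigs function, and $\Omega=h(\mathbb{D})$ is the Koenigs domain of the semigroup. The hyperbolic distance $\rho_{\mathbb{D}}$ is the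 distance induced by the metric $|dz|/(1-|z|^2)$, i.e. $\rho_{\mathbb{D}}(z,w)=\frac12\log\frac{1+|T(z,w)|}{1-|T(z,w)|}$ with $T(z,w)=\frac{z-w}{1-z\overline{w}}$. The diameter $(-\tau,\tau)=\{r\tau:-1<r<1\}$ is a hyperbolic geodesic. For $t\ge0$, $\pi(\phi_t(0))$ is the (unique) point of $(-\tau,\tau)$ at least hyperbolic distance from $\phi_t(0)$. The orthogonal speed is $v^o(t)=\rho_{\mathbb{D}}(0,\pi(\phi_t(0)))$, $t\ge 0$; $\widetilde{v}^o$ is defined in the same way from $(\widetilde{\phi}_t)$ and $\widetilde{\tau}$. *)

theory Defs
  imports "HOL-Complex_Analysis.Complex_Analysis"
begin

abbreviation unit_disk :: "complex set" where
  "unit_disk \<equiv> ball 0 1"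

text \<open>Only parameters \<open>t \<ge> 0\<close> and points of the disk are constrained; the values of
  \<open>\<phi>\<close> elsewhere are irrelevant.\<close>

definition holomorphic_semigroup :: "(real \<Rightarrow> complex \<Rightarrow> complex) \<Rightarrow> bool" where
  "holomorphic_semigroup \<phi> \<longleftrightarrow>
     (\<forall>t\<ge>0. \<phi> t holomorphic_on unit_disk \<and> \<phi> t ` unit_disk \<subseteq> unit_disk) \<and>
     (\<forall>z\<in>unit_disk. \<phi> 0 z = z) \<and>
     (\<forall>t\<ge>0. \<forall>s\<ge>0. \<forall>z\<in>unit_disk. \<phi> (t + s) z = \<phi> t (\<phi> s z)) \<and>
     (\<forall>s\<ge>0. \<forall>z\<in>unit_disk. ((\<lambda>t. \<phi> t z) \<longlongrightarrow> \<phi> s z) (at s within {0..}))"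

definition non_elliptic_semigroup :: "(real \<Rightarrow> complex \<Rightarrow> complex) \<Rightarrow> bool" where
  "non_elliptic_semigroup \<phi> \<longleftrightarrow>
     holomorphic_semigroup \<phi> \<and> (\<forall>t>0. \<forall>z\<in>unit_disk. \<phi> t z \<noteq> z)"

definition is_Denjoy_Wolff_point :: "(real \<Rightarrow> complex \<Rightarrow> complex) \<Rightarrow> complex \<Rightarrow> bool" where
  "is_Denjoy_Wolff_point \<phi> \<tau> \<longleftrightarrow>
     \<tau> \<in> sphere 0 1 \<and> (\<forall>z\<in>unit_disk. ((\<lambda>t. \<phi> t z) \<longlongrightarrow> \<tau>) at_top)"

text \<open>The membership \<open>h z + t \<in> h ` unit_disk\<close> is what makes the inverse of \<open>h\<close> meaningful
  at that point, since \<^const>\<open>inv_into\<close> is total.\<close>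

definition is_Koenigs_function ::
    "(real \<Rightarrow> complex \<Rightarrow> complex) \<Rightarrow> (complex \<Rightarrow> complex) \<Rightarrow> bool" where
  "is_Koenigs_function \<phi> h \<longleftrightarrow>
     h holomorphic_on unit_disk \<and> inj_on h unit_disk \<and> h 0 = 0 \<and>
     (\<forall>z\<in>unit_disk. \<forall>t\<ge>0. h z + of_real t \<in> h ` unit_disk \<and>
        \<phi> t z = inv_into unit_disk h (h z + of_real t))"

definition is_Koenigs_domain ::
    "(real \<Rightarrow> complex \<Rightarrow> complex) \<Rightarrow> complex set \<Rightarrow> bool" where
  "is_Koenigs_domain \<phi> \<Omega> \<longleftrightarrow> (\<exists>h. is_Koenigs_function \<phi> h \<and> \<Omega> = h ` unit_disk)"

definition pseudo_hyp :: "complex \<Rightarrow> complex \<Rightarrow> complex" where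
  "pseudo_hyp z w = (z - w) / (1 - z * cnj w)"

text \<open>Normalised as the distance of the metric \<open>|dz| / (1 - |z|^2)\<close>, of curvature \<open>-4\<close>.
  Meaningful only for arguments in the disk.\<close>

definition hyp_dist :: "complex \<Rightarrow> complex \<Rightarrow> real" where
  "hyp_dist z w =
     1 / 2 * ln ((1 + cmod (pseudo_hyp z w)) / (1 - cmod (pseudo_hyp z w)))"

definition diameter_to :: "complex \<Rightarrow> complex set" where
  "diameter_to \<tau> = {of_real r * \<tau> | r::real. -1 < r \<and> r < 1}"

definition hyp_proj :: "complex \<Rightarrow> complex \<Rightarrow> complex" where
  "hyp_proj \<tau> z =
     (THE w. w \<in> diameter_to \<tau> \<and> (\<forall>u\<in>diameter_to \<tau>. hyp_dist z w \<le> hyp_dist z u))"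

definition orthogonal_speed ::
    "(real \<Rightarrow> complex \<Rightarrow> complex) \<Rightarrow> complex \<Rightarrow> real \<Rightarrow> real" where
  "orthogonal_speed \<phi> \<tau> t = hyp_dist 0 (hyp_proj \<tau> (\<phi> t 0))"

end

theory Submission
  imports Defs
begin

text \<open>
  Send the Denjoy-Wolff point to infinity by a Cayley transform onto the right half-plane, with 0
  going to 1. If \<open>W t\<close> is the orbit of 1, then the projection onto the diameter becomes
  \<open>W t \<mapsto> |W t|\<close>, so the orthogonal speed is \<open>1/2 ln |W t|\<close> as soon as \<open>|W t| \<ge> 1\<close>, and
  the claim is that \<open>|W' t| \<le> (4 + o(1)) |W t|\<close>.

  The inclusion of the Koenigs domains gives a holomorphic self-map \<open>g\<close> of the half-plane with
  \<open>g 1 = 1\<close> and \<open>g (W t) = W' t\<close>. The orbit moves outwards, so \<open>g\<close> maps the tail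
  \<open>{W s | s \<ge> t}\<close> into \<open>{|w| \<ge> R'}\<close>, where \<open>R' = |W' t|\<close>. Seen from 1, the harmonic measure of the
  half circle of radius \<open>R'\<close> is \<open>(4/\<pi>) arctan (1/R')\<close>, and the harmonic measure of any curve
  joining \<open>W t\<close> to infinity is at least \<open>(1/\<pi>) arctan (1/|W t|)\<close>; the maximum principle compares
  the two. The constant 4 is the quotient of these two bounds.
\<close>

section \<open>Schwarz integral formula and an inequality for functions of positive real part\<close>

text \<open>The obstacle is that the orbit moves outwards. Julia's inequality makes the real part of
  the orbit nondecreasing, but the comparison needs its modulus nondecreasing, for the orbit in the
  larger domain. Let k be the Koenigs function on the half-plane. The orbit w has velocity 1 /
  k'(w), so the derivative of |w|^2 has the sign of Re (w k'(w)). This sign does not follow from Re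
  k' >= 0 alone; it also needs that the integral of k' from 1 to w is the real number t. So an
  inequality is set up, linear in q and valid for every holomorphic q with Re q >= 0, that couples
  Re (w q(w)) with the imaginary part of the integral of q. By linearity it reduces to explicit
  kernels, where it is an inequality between arctangents.

  The bound for the tail rests on a square root branched only at the tip \<open>orbit t\<close>. It
  needs no information on the shape of the tail beyond the fact that it stays to the right of its
  tip.

  The constant: arctan (1/R) behaves like 1/R for large R, so the quotient 4 of the harmonic
  measures becomes a factor 4 between the moduli, and half its logarithm is ln 2.\<close>

lemma arctan_diff_le:
  fixes p m :: real
  assumes "0 \<le> m" "m \<le> p"
  shows "arctan p - arctan m \<le> (p - m) / (1 + p * m)"
proof -
  define f where "f = (\<lambda>p. (p - m) / (1 + p * m) - arctan p)"
  have "f m \<le> f p"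
  proof (rule DERIV_nonneg_imp_nondecreasing[OF assms(2)])
    fix t assume t: "m \<le> t" "t \<le> p"
    have p1: "1 + t * m > 0" using t assms by (simp add: add_pos_nonneg)
    have "(f has_real_derivative ((1 + t * m) - (t - m) * m) / (1 + t * m)\<^sup>2 - 1 / (1 + t\<^sup>2)) (at t)"
      unfolding f_def using p1
      by (auto intro!: derivative_eq_intros simp: power2_eq_square inverse_eq_divide)
    moreover have "((1 + t * m) - (t - m) * m) / (1 + t * m)\<^sup>2 - 1 / (1 + t\<^sup>2) \<ge> 0"
    proof -
      have "(1 + t * m)\<^sup>2 \<le> (1 + m\<^sup>2) * (1 + t\<^sup>2)"
        using zero_le_power2[of "t - m"] by (simp add: power2_eq_square algebra_simps)
      moreover have "0 < 1 + t\<^sup>2" by (simp add: add_pos_nonneg)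
      moreover have "(1 + t * m) - (t - m) * m = 1 + m\<^sup>2" by (simp add: power2_eq_square algebra_simps)
      moreover have "0 < 1 + m\<^sup>2" by (simp add: add_pos_nonneg)
      ultimately have "(1 + m\<^sup>2) / ((1 + m\<^sup>2) * (1 + t\<^sup>2)) \<le> ((1 + t * m) - (t - m) * m) / (1 + t * m)\<^sup>2"
        using p1 by (simp only:, intro divide_left_mono) auto
      moreover have "(1 + m\<^sup>2) / ((1 + m\<^sup>2) * (1 + t\<^sup>2)) = 1 / (1 + t\<^sup>2)"
        using \<open>0 < 1 + m\<^sup>2\<close> by simp
      ultimately show ?thesis by simp
    qed
    ultimately show "\<exists>y. (f has_real_derivative y) (at t) \<and> 0 \<le> y" by blast
  qed
  then show ?thesis by (simp add: f_def)
qed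

text \<open>By the addition formula, with X = (p - m) / (1 + p m), the difference of arctangents is
  arctan X, and X / (1 + X^2) <= arctan X <= X. Since (1 + p^2) (1 + m^2) = (1 + p m)^2 + (p - m)^2,
  the bound here is X / (1 + X^2), while \<open>arctan_diff_le\<close> has X.\<close>

lemma arctan_diff_ge:
  fixes p m :: real
  assumes "0 \<le> m" "m \<le> p"
  shows "(p - m) * (1 + p * m) / ((1 + p\<^sup>2) * (1 + m\<^sup>2)) \<le> arctan p - arctan m"
proof -
  define C where "C = 1 / (1 + m\<^sup>2)"
  define f where "f = (\<lambda>p. arctan p - C * ((p - m) * (1 + p * m) / (1 + p\<^sup>2)))"
  have "f m \<le> f p"
  proof (rule DERIV_nonneg_imp_nondecreasing[OF assms(2)])
    fix t assume t: "m \<le> t" "t \<le> p"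
    have p1: "1 + t\<^sup>2 > 0" "1 + m\<^sup>2 > 0" by (simp_all add: add_pos_nonneg)
    define N where "N = (1 + t * m + (t - m) * m) * (1 + t\<^sup>2) - (t - m) * (1 + t * m) * (2 * t)"
    have "(f has_real_derivative 1 / (1 + t\<^sup>2) - C * (N / (1 + t\<^sup>2)\<^sup>2)) (at t)"
      unfolding f_def N_def using p1
      by (auto intro!: derivative_eq_intros simp: inverse_eq_divide power2_eq_square)
         (simp add: algebra_simps)
    moreover have "1 / (1 + t\<^sup>2) - C * (N / (1 + t\<^sup>2)\<^sup>2) \<ge> 0"
    proof -
      have "(1 + t\<^sup>2) * (1 + m\<^sup>2) - N = 2 * (t - m)\<^sup>2"
        unfolding N_def by (simp add: power2_eq_square algebra_simps)
      then have "N \<le> (1 + t\<^sup>2) * (1 + m\<^sup>2)" using zero_le_power2[of "t - m"] by linarith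
      then have "C * (N / (1 + t\<^sup>2)\<^sup>2) \<le> C * ((1 + t\<^sup>2) * (1 + m\<^sup>2) / (1 + t\<^sup>2)\<^sup>2)"
        using p1 unfolding C_def by (intro mult_left_mono divide_right_mono) auto
      also have "\<dots> = 1 / (1 + t\<^sup>2)" using p1 by (simp add: C_def power2_eq_square)
      finally show ?thesis by simp
    qed
    ultimately show "\<exists>y. (f has_real_derivative y) (at t) \<and> 0 \<le> y" by blast
  qed
  then show ?thesis by (simp add: f_def C_def mult.commute)
qed

text \<open>The expression is the value of \<open>chord_functional\<close> on the kernel with pole i
  a, a = y - b, up to the factor 1 + a^2; the arctangents are the arguments of w - i a and 1 - i a.
  In case (a) both terms are nonnegative. In (b) only the angle term can be negative, and
  \<open>arctan_diff_le\<close> controls it; in (c) only the rational term can be, and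
  \<open>arctan_diff_ge\<close> makes the angle term large enough.\<close>

lemma arctan_kernel_nonneg_pos:
  fixes x y b :: real
  assumes x: "1 \<le> x" and y: "0 \<le> y"
  shows "0 \<le> (x - 1) * (x\<^sup>2 + y * b) / (x\<^sup>2 + b\<^sup>2) + y * (arctan (b / x) - arctan (b - y))"
proof -
  have den: "0 < x\<^sup>2 + b\<^sup>2" using x by (simp add: add_pos_nonneg)
  consider (a) "b - y \<le> b / x" "0 \<le> x\<^sup>2 + y * b" | (b) "0 \<le> b" "b / x \<le> b - y"
    | (c) "b \<le> 0" "x\<^sup>2 + y * b \<le> 0"
  proof -
    have "b - y \<le> b / x" if "b \<le> 0"
    proof -
      have "b * x \<le> b * 1" using that x by (intro mult_left_mono_neg) auto
      then have "b \<le> b / x" using x by (simp add: le_divide_eq)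
      then show ?thesis using y by linarith
    qed
    moreover have "0 \<le> x\<^sup>2 + y * b" if "0 \<le> b" using that y by simp
    ultimately show ?thesis using that by linarith
  qed
  then show ?thesis
  proof cases
    case a
    then have "arctan (b - y) \<le> arctan (b / x)" by (simp add: arctan_monotone')
    then have "0 \<le> y * (arctan (b / x) - arctan (b - y))" using y by simp
    moreover have "0 \<le> (x - 1) * (x\<^sup>2 + y * b) / (x\<^sup>2 + b\<^sup>2)" using a x den by simp
    ultimately show ?thesis by simp
  next
    case b
    define N where "N = b * x - x * y - b"
    define D where "D = x + b * (b - y)"
    have b_y: "0 \<le> b - y" using b x by (meson divide_nonneg_nonneg order_trans zero_le_one)
    have D: "0 < D" unfolding D_def using x b by (intro add_pos_nonneg mult_nonneg_nonneg b_y) auto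
    have "arctan (b - y) - arctan (b / x) \<le> ((b - y) - b / x) / (1 + (b - y) * (b / x))"
      using b x by (intro arctan_diff_le) auto
    also have "\<dots> = N / D"
    proof -
      have "((b - y) - b / x) = N / x" "1 + (b - y) * (b / x) = D / x"
        unfolding N_def D_def using x by (auto simp: field_simps)
      then show ?thesis using x by simp
    qed
    finally have 1: "arctan (b - y) - arctan (b / x) \<le> N / D" .
    have 2: "y * (N / D) \<le> (x - 1) * (x\<^sup>2 + y * b) / (x\<^sup>2 + b\<^sup>2)"
    proof -
      \<comment> \<open>With denominators cleared, the gap is a sum of nonnegative terms; the
        bracket is regrouped below around the square of x b - x y.\<close>
      have eq: "(x - 1) * (x\<^sup>2 + y * b) * D - y * N * (x\<^sup>2 + b\<^sup>2)
        = (x - 1) * x ^ 3 + (x - 1) * (x * y * b) + ((x - 1) * x\<^sup>2 * b\<^sup>2 - 2 * (x - 1) * x\<^sup>2 * y * b + y\<^sup>2 * b\<^sup>2 + x ^ 3 * y\<^sup>2)"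
        unfolding N_def D_def by (simp add: power2_eq_square power3_eq_cube algebra_simps)
      have "0 \<le> (x - 1) * (x * b - x * y)\<^sup>2" using x by simp
      moreover have "(x - 1) * x\<^sup>2 * b\<^sup>2 - 2 * (x - 1) * x\<^sup>2 * y * b + y\<^sup>2 * b\<^sup>2 + x ^ 3 * y\<^sup>2
         = (x - 1) * (x * b - x * y)\<^sup>2 + y\<^sup>2 * b\<^sup>2 + x\<^sup>2 * y\<^sup>2"
        by (simp add: power2_eq_square power3_eq_cube algebra_simps)
      moreover have "0 \<le> (x - 1) * x ^ 3" "0 \<le> (x - 1) * (x * y * b)" using x y b by auto
      moreover have "0 \<le> y\<^sup>2 * b\<^sup>2" "0 \<le> x\<^sup>2 * y\<^sup>2" by simp_all
      ultimately have "y * N * (x\<^sup>2 + b\<^sup>2) \<le> (x - 1) * (x\<^sup>2 + y * b) * D"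
        using eq by linarith
      then show ?thesis using D den by (simp add: divide_le_eq le_divide_eq field_simps)
    qed
    have "y * (arctan (b - y) - arctan (b / x)) \<le> y * (N / D)" using 1 y by (rule mult_left_mono)
    then show ?thesis using 2 by (simp add: algebra_simps)
  next
    case c
    define c where "c = - b"
    define D where "D = x + c * (c + y)"
    have c0: "0 \<le> c" "x\<^sup>2 \<le> y * c" using c by (auto simp: c_def)
    have P: "0 < 1 + (c + y)\<^sup>2" by (simp add: add_pos_nonneg)
    have D: "0 < D" unfolding D_def using x y c0 by (simp add: add_pos_nonneg)
    have cx: "c / x \<le> c" using c0 x by (simp add: divide_le_eq mult_le_cancel_left1)
    have "((c + y) - c / x) * (1 + (c + y) * (c / x)) / ((1 + (c + y)\<^sup>2) * (1 + (c / x)\<^sup>2))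
        \<le> arctan (c + y) - arctan (c / x)"
      using c0 x y cx by (intro arctan_diff_ge) auto
    also have "((c + y) - c / x) * (1 + (c + y) * (c / x)) / ((1 + (c + y)\<^sup>2) * (1 + (c / x)\<^sup>2))
        = (x * (c + y) - c) * D / ((1 + (c + y)\<^sup>2) * (x\<^sup>2 + c\<^sup>2))"
    proof -
      have "((c + y) - c / x) = (x * (c + y) - c) / x" "1 + (c + y) * (c / x) = D / x"
        "1 + (c / x)\<^sup>2 = (x\<^sup>2 + c\<^sup>2) / x\<^sup>2"
        unfolding D_def using x by (auto simp: field_simps power2_eq_square)
      then show ?thesis using x by (simp add: power2_eq_square)
    qed
    finally have 1: "(x * (c + y) - c) * D / ((1 + (c + y)\<^sup>2) * (x\<^sup>2 + c\<^sup>2)) \<le> arctan (c + y) - arctan (c / x)" .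
    have 2: "(x - 1) * (y * c - x\<^sup>2) / (x\<^sup>2 + c\<^sup>2)
        \<le> y * ((x * (c + y) - c) * D / ((1 + (c + y)\<^sup>2) * (x\<^sup>2 + c\<^sup>2)))"
    proof -
      have "(y * c - x\<^sup>2) * (1 + (c + y)\<^sup>2) \<le> y * c * (1 + (c + y)\<^sup>2) - 0"
        using P by (simp add: algebra_simps)
      also have "\<dots> \<le> y * (c + y) * D"
      proof -
        have "y * c \<le> y * (c + y) * x"
        proof -
          have "y * c \<le> y * (c + y)" using y by (simp add: mult_left_mono)
          moreover have "y * (c + y) * 1 \<le> y * (c + y) * x" using x y c0 by (intro mult_left_mono) auto
          ultimately show ?thesis by simp
        qed
        then show ?thesis unfolding D_def by (simp add: power2_eq_square algebra_simps)
      qed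
      finally have "(x - 1) * ((y * c - x\<^sup>2) * (1 + (c + y)\<^sup>2)) \<le> (x - 1) * (y * (c + y) * D)"
        using x by (intro mult_left_mono) auto
      also have "\<dots> = y * D * ((x - 1) * (c + y))" by simp
      also have "\<dots> \<le> y * D * (x * (c + y) - c)"
        using y D by (intro mult_left_mono) (auto simp: algebra_simps)
      finally have *: "(x - 1) * (y * c - x\<^sup>2) * (1 + (c + y)\<^sup>2) \<le> y * (x * (c + y) - c) * D"
        by (simp add: algebra_simps)
      have den': "0 < x\<^sup>2 + c\<^sup>2" using den by (simp add: c_def)
      have "(x - 1) * (y * c - x\<^sup>2) \<le> y * (x * (c + y) - c) * D / (1 + (c + y)\<^sup>2)"
        using * P by (simp add: le_divide_eq)
      then have "(x - 1) * (y * c - x\<^sup>2) / (x\<^sup>2 + c\<^sup>2) \<le> (y * (x * (c + y) - c) * D / (1 + (c + y)\<^sup>2)) / (x\<^sup>2 + c\<^sup>2)"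
        using den' by (intro divide_right_mono) auto
      then show ?thesis by (simp add: mult.assoc)
    qed
    have "y * ((x * (c + y) - c) * D / ((1 + (c + y)\<^sup>2) * (x\<^sup>2 + c\<^sup>2))) \<le> y * (arctan (c + y) - arctan (c / x))"
      using 1 y by (rule mult_left_mono)
    then have *: "(x - 1) * (y * c - x\<^sup>2) / (x\<^sup>2 + c\<^sup>2) \<le> y * (arctan (c + y) - arctan (c / x))"
      using 2 by linarith
    have "b - y = - (c + y)" "b / x = - (c / x)" by (auto simp: c_def)
    then have e: "arctan (b / x) - arctan (b - y) = arctan (c + y) - arctan (c / x)"
      by (simp only: arctan_minus)
    have "(x - 1) * (x\<^sup>2 + y * b) / (x\<^sup>2 + b\<^sup>2) = - ((x - 1) * (y * c - x\<^sup>2) / (x\<^sup>2 + c\<^sup>2))"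
      by (simp add: c_def divide_simps) (simp add: algebra_simps)
    then show ?thesis using * unfolding e by linarith
  qed
qed

text \<open>Changing the signs of y and b together leaves the expression unchanged.\<close>

lemma arctan_kernel_nonneg:
  fixes x y b :: real
  assumes x: "1 \<le> x"
  shows "0 \<le> (x - 1) * (x\<^sup>2 + y * b) / (x\<^sup>2 + b\<^sup>2) + y * (arctan (b / x) - arctan (b - y))"
proof (cases "0 \<le> y")
  case True
  then show ?thesis using arctan_kernel_nonneg_pos[OF x] by blast
next
  case False
  then have "0 \<le> (x - 1) * (x\<^sup>2 + (-y) * (-b)) / (x\<^sup>2 + (-b)\<^sup>2) + (-y) * (arctan ((-b) / x) - arctan ((-b) - (-y)))"
    using x by (intro arctan_kernel_nonneg_pos) auto
  moreover have "arctan ((-b) - (-y)) = - arctan (b - y)"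
    by (metis arctan_minus minus_diff_eq minus_diff_minus)
  ultimately show ?thesis by (simp add: arctan_minus algebra_simps)
qed

section \<open>Schwarz's formula on the unit circle\<close>

lemma Cauchy_integral_unit_circle:
  assumes "f holomorphic_on cball 0 1" "z \<in> ball 0 1"
  shows "((\<lambda>t. f (cis (2 * pi * t)) * (cis (2 * pi * t) / (cis (2 * pi * t) - z))) has_integral f z) {0..1}"
proof -
  have e: "exp (2 * of_real pi * \<i> * of_real t) = cis (2 * pi * t)" for t
    by (simp add: cis_conv_exp mult_ac)
  have "((\<lambda>u. f u / (u - z)) has_contour_integral (2 * of_real pi * \<i> * f z)) (circlepath 0 1)"
    by (rule Cauchy_integral_circlepath_simple) (use assms in auto)
  then have "((\<lambda>t. f (cis (2 * pi * t)) / (cis (2 * pi * t) - z) * (2 * pi * \<i> * cis (2 * pi * t)))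
      has_integral (2 * of_real pi * \<i> * f z)) {0..1}"
    unfolding has_contour_integral_def
  proof (rule has_integral_eq[rotated])
    fix t :: real assume "t \<in> {0..1}"
    then have "vector_derivative (circlepath 0 1) (at t within {0..1}) = 2 * pi * \<i> * cis (2 * pi * t)"
      by (subst vector_derivative_circlepath01) (auto simp: e)
    moreover have "circlepath 0 1 t = cis (2 * pi * t)" by (simp add: circlepath e)
    ultimately show "f (circlepath 0 1 t) / (circlepath 0 1 t - z) * vector_derivative (circlepath 0 1) (at t within {0..1})
      = f (cis (2 * pi * t)) / (cis (2 * pi * t) - z) * (2 * pi * \<i> * cis (2 * pi * t))" by simp
  qed
  then have "((\<lambda>t. (1 / (2 * of_real pi * \<i>)) * (f (cis (2 * pi * t)) / (cis (2 * pi * t) - z) * (2 * pi * \<i> * cis (2 * pi * t))))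
      has_integral ((1 / (2 * of_real pi * \<i>)) * (2 * of_real pi * \<i> * f z))) {0..1}"
    by (rule has_integral_mult_right)
  then show ?thesis by (simp add: field_simps)
qed

text \<open>Cauchy's formula for f at z is added to the conjugate of Cauchy's formula for f(u) / (1
  - cnj z * u) at 0. As cnj u = 1 / u on the circle, both carry the kernel u / (u - z), so the sum
  has density 2 Re f against it. Subtracting the mean of Re f turns the kernel into (u + z) / (u -
  z).\<close>

lemma Schwarz_integral_formula:
  assumes f: "f holomorphic_on cball 0 1" and z: "z \<in> ball 0 1"
  shows "((\<lambda>t. of_real (Re (f (cis (2 * pi * t)))) * ((cis (2 * pi * t) + z) / (cis (2 * pi * t) - z)))
    has_integral (f z - \<i> * of_real (Im (f 0)))) {0..1}"
proof -
  let ?c = "\<lambda>t. cis (2 * pi * t)"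
  have 1: "((\<lambda>t. f (?c t) * (?c t / (?c t - z))) has_integral f z) {0..1}"
    using Cauchy_integral_unit_circle[OF f z] .
  have 2: "((\<lambda>t. f (?c t)) has_integral f 0) {0..1}"
    using Cauchy_integral_unit_circle[OF f, of 0] by simp
  have nz: "1 - cnj z * u \<noteq> 0" if "norm u \<le> 1" for u
  proof -
    have "norm (cnj z * u) < 1"
      using z that by (simp add: norm_mult) (metis mult_left_le le_less_trans norm_ge_zero)
    then show ?thesis by force
  qed
  have "(\<lambda>u. f u / (1 - cnj z * u)) holomorphic_on cball 0 1"
    by (intro holomorphic_intros f) (use nz in auto)
  from Cauchy_integral_unit_circle[OF this, of 0]
  have "((\<lambda>t. f (?c t) / (1 - cnj z * ?c t)) has_integral f 0) {0..1}" by simp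
  from has_integral_linear[OF this bounded_linear_cnj]
  have 3: "((\<lambda>t. cnj (f (?c t)) / (1 - z * cnj (?c t))) has_integral cnj (f 0)) {0..1}"
    by (simp add: o_def)
  have 4: "((\<lambda>t. cnj (f (?c t))) has_integral cnj (f 0)) {0..1}"
    using has_integral_linear[OF 2 bounded_linear_cnj] by (simp add: o_def)
  have "((\<lambda>t. f (?c t) * (?c t / (?c t - z)) + cnj (f (?c t)) / (1 - z * cnj (?c t))
        - (f (?c t) + cnj (f (?c t))) * (1/2)) has_integral (f z + cnj (f 0) - (f 0 + cnj (f 0)) * (1/2))) {0..1}"
    by (intro has_integral_add has_integral_diff has_integral_mult_left 1 2 3 4)
  moreover have "f (?c t) * (?c t / (?c t - z)) + cnj (f (?c t)) / (1 - z * cnj (?c t))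
        - (f (?c t) + cnj (f (?c t))) * (1/2) = of_real (Re (f (?c t))) * ((?c t + z) / (?c t - z))" for t
  proof -
    have cz: "?c t - z \<noteq> 0" using z by auto
    have "?c t * (1 - z * cnj (?c t)) = ?c t - z"
      by (simp add: algebra_simps cis_cnj cis_mult)
    then have inv: "1 / (1 - z * cnj (?c t)) = ?c t / (?c t - z)"
      using cz by (metis divide_self_if mult.right_neutral mult_eq_0_iff nonzero_mult_divide_mult_cancel_left)
    have k: "(?c t + z) / (?c t - z) = 2 * (?c t / (?c t - z)) - 1"
      using cz by (simp add: field_simps)
    have r: "of_real (Re (f (?c t))) = (f (?c t) + cnj (f (?c t))) / 2"
      by (simp add: complex_add_cnj)
    have d: "cnj (f (?c t)) / (1 - z * cnj (?c t)) = cnj (f (?c t)) * (?c t / (?c t - z))"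
      using inv by (metis times_divide_eq_right mult.right_neutral)
    show ?thesis unfolding d k r by (simp add: algebra_simps add_divide_distrib)
  qed
  moreover have "f z + cnj (f 0) - (f 0 + cnj (f 0)) * (1/2) = f z - \<i> * of_real (Im (f 0))"
    by (simp add: complex_eq_iff)
  ultimately show ?thesis by (simp only:)
qed

text \<open>The factors are balanced so that the functional vanishes on imaginary constants. By the Schwarz
  formula its positivity then only has to be checked on the Cayley kernels.\<close>

definition chord_functional :: "complex \<Rightarrow> (complex \<Rightarrow> complex) \<Rightarrow> real" where
  "chord_functional w p = (Re w - 1) * Re (w * p w) +
     Im w * Im ((w - 1) * integral {0..1} (\<lambda>s. p (1 + of_real s * (w - 1))))"

lemma Re_chord_pos:
  assumes "1 \<le> Re w" "s \<in> {0..1}"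
  shows "0 < Re (1 + of_real s * (w - 1))"
  using assms by (simp add: add_pos_nonneg)

lemma chord_integral:
  assumes w: "1 \<le> Re w" and P: "\<And>v. 0 < Re v \<Longrightarrow> (P has_field_derivative p v) (at v)"
  shows "(w - 1) * integral {0..1} (\<lambda>s. p (1 + of_real s * (w - 1))) = P w - P 1"
proof -
  have "((\<lambda>s. (w - 1) * p (1 + of_real s * (w - 1))) has_integral
      P (1 + of_real 1 * (w - 1)) - P (1 + of_real 0 * (w - 1))) {0..1}"
  proof (rule fundamental_theorem_of_calculus)
    fix s :: real assume s: "s \<in> {0..1}"
    have "(P has_field_derivative p (1 + of_real s * (w - 1))) (at (1 + of_real s * (w - 1)))"
      by (rule P) (rule Re_chord_pos[OF w s])
    moreover have "((\<lambda>s. 1 + of_real s * (w - 1)) has_vector_derivative (w - 1)) (at s within {0..1})"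
      by (auto intro!: derivative_eq_intros has_vector_derivative_real_field simp: has_vector_derivative_def scaleR_conv_of_real)
    ultimately show "((\<lambda>s. P (1 + of_real s * (w - 1))) has_vector_derivative
        (w - 1) * p (1 + of_real s * (w - 1))) (at s within {0..1})"
      using field_vector_diff_chain_within[of "\<lambda>s. 1 + of_real s * (w - 1)" "w - 1" s "{0..1}" P]
      by (simp add: o_def has_field_derivative_at_within)
  qed simp
  then have "integral {0..1} (\<lambda>s. (w - 1) * p (1 + of_real s * (w - 1))) =
      P (1 + of_real 1 * (w - 1)) - P (1 + of_real 0 * (w - 1))"
    by (rule integral_unique)
  moreover have "P (1 + of_real 1 * (w - 1)) - P (1 + of_real 0 * (w - 1)) = P w - P 1" by simp
  ultimately show ?thesis by (simp only: integral_mult_right)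
qed

lemma Im_Ln_arctan: "0 < Re z \<Longrightarrow> Im (Ln z) = arctan (Im z / Re z)"
  by (metis Arg_eq_Im_Ln arg_conv_arctan order_less_irrefl zero_complex.simps(1))

text \<open>Seen in the half-plane, the Schwarz kernel has its pole at the boundary point i a = (1 +
  \<zeta>) / (1 - \<zeta>), which is infinity for \<zeta> = 1. The kernel is v in that case and (1 +
  a^2) / (v - i a) - i a otherwise. Explicit primitives evaluate the chord integral, and the finite
  pole leads to \<open>arctan_kernel_nonneg\<close>.\<close>

lemma chord_functional_kernel:
  assumes w: "1 \<le> Re w" and z: "norm \<zeta> = 1"
  shows "0 \<le> chord_functional w (\<lambda>v. (\<zeta> + (v - 1) / (v + 1)) / (\<zeta> - (v - 1) / (v + 1)))"
    (is "0 \<le> chord_functional w ?k")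
proof (cases "\<zeta> = 1")
  case True
  define x y where "x = Re w" and "y = Im w"
  have wxy: "w = Complex x y" by (simp add: x_def y_def complex_eq_iff)
  have k: "?k v = v" if "0 < Re v" for v
  proof -
    have "v + 1 \<noteq> 0" using that by (auto simp: complex_eq_iff)
    then have "1 + (v - 1) / (v + 1) = 2 * v / (v + 1)" "1 - (v - 1) / (v + 1) = 2 / (v + 1)"
      by (simp_all add: field_simps)
    then show ?thesis using True \<open>v + 1 \<noteq> 0\<close> by simp
  qed
  have "((\<lambda>v. v\<^sup>2 / 2) has_field_derivative ?k v) (at v)" if "0 < Re v" for v
    unfolding k[OF that] by (auto intro!: derivative_eq_intros)
  from chord_integral[OF w this]
  have "chord_functional w ?k = (x - 1) * Re (w * w) + y * Im (w\<^sup>2 / 2 - 1 / 2)"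
    unfolding chord_functional_def using k[of w] w by (simp add: x_def y_def)
  also have "\<dots> = (x - 1) * x\<^sup>2 + y\<^sup>2"
    by (simp add: wxy power2_eq_square algebra_simps)
  finally show ?thesis using w by (simp add: x_def)
next
  case False
  define x y where "x = Re w" and "y = Im w"
  define a where "a = Im ((1 + \<zeta>) / (1 - \<zeta>))"
  define A where "A = 1 + a\<^sup>2"
  define b where "b = y - a"
  have x1: "1 \<le> x" using w by (simp add: x_def)
  have wxy: "w = Complex x y" by (simp add: x_def y_def complex_eq_iff)
  have d0: "1 - \<zeta> \<noteq> 0" using False by simp
  have ia: "(1 + \<zeta>) / (1 - \<zeta>) = \<i> * of_real a"
  proof -
    have "Re ((1 + \<zeta>) / (1 - \<zeta>)) = 0"
    proof -
      have "(Re \<zeta>)\<^sup>2 + (Im \<zeta>)\<^sup>2 = 1" using z by (simp add: cmod_power2[symmetric])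
      then show ?thesis by (simp add: Re_divide power2_eq_square algebra_simps)
    qed
    then show ?thesis by (simp add: a_def complex_eq_iff)
  qed
  have k: "?k v = of_real A / (v - \<i> * of_real a) - \<i> * of_real a" if v: "0 < Re v" for v
  proof -
    have v1: "v + 1 \<noteq> 0" using v by (auto simp: complex_eq_iff)
    have va: "v - \<i> * of_real a \<noteq> 0" using v by (auto simp: complex_eq_iff)
    have "\<zeta> + (v - 1) / (v + 1) = (v * (1 + \<zeta>) - (1 - \<zeta>)) / (v + 1)"
      "\<zeta> - (v - 1) / (v + 1) = ((1 + \<zeta>) - v * (1 - \<zeta>)) / (v + 1)"
      using v1 by (simp_all add: field_simps)
    then have "?k v = (v * (1 + \<zeta>) - (1 - \<zeta>)) / ((1 + \<zeta>) - v * (1 - \<zeta>))"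
      using v1 by simp
    also have "1 + \<zeta> = \<i> * of_real a * (1 - \<zeta>)" using ia d0 by (simp add: field_simps)
    also have "(v * (\<i> * of_real a * (1 - \<zeta>)) - (1 - \<zeta>)) / (\<i> * of_real a * (1 - \<zeta>) - v * (1 - \<zeta>))
       = ((v * \<i> * of_real a - 1) * (1 - \<zeta>)) / ((\<i> * of_real a - v) * (1 - \<zeta>))"
      by (simp add: algebra_simps)
    also have "\<dots> = (v * \<i> * of_real a - 1) / (\<i> * of_real a - v)" using d0 by simp
    also have "\<dots> = of_real A / (v - \<i> * of_real a) - \<i> * of_real a"
    proof -
      have "\<i> * of_real a - v \<noteq> 0" using va by auto
      then show ?thesis using va unfolding A_def
        by (simp add: field_simps power2_eq_square)
    qed
    finally show ?thesis .
  qed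
  have "((\<lambda>v. of_real A * Ln (v - \<i> * of_real a) - \<i> * of_real a * v) has_field_derivative ?k v) (at v)" if "0 < Re v" for v
    unfolding k[OF that] using that
    by (auto intro!: derivative_eq_intros simp: complex_nonpos_Reals_iff divide_inverse)
  from chord_integral[OF w this]
  have "chord_functional w ?k = (x - 1) * Re (w * (of_real A / (w - \<i> * of_real a) - \<i> * of_real a))
     + y * Im (of_real A * Ln (w - \<i> * of_real a) - \<i> * of_real a * w - (of_real A * Ln (1 - \<i> * of_real a) - \<i> * of_real a))"
    unfolding chord_functional_def using k[of w] w by (simp add: x_def y_def)
  also have "\<dots> = A * ((x - 1) * (x\<^sup>2 + y * b) / (x\<^sup>2 + b\<^sup>2) + y * (arctan (b / x) - arctan (b - y)))"
  proof -
    have "Re (w * (of_real A / (w - \<i> * of_real a))) = A * ((x\<^sup>2 + y * b) / (x\<^sup>2 + b\<^sup>2))"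
      by (simp add: wxy Re_divide Im_divide b_def power2_eq_square) (simp add: add_divide_distrib[symmetric] algebra_simps)
    moreover have "Im (Ln (w - \<i> * of_real a)) = arctan (b / x)"
      using x1 by (subst Im_Ln_arctan) (auto simp: wxy b_def)
    moreover have "Im (Ln (1 - \<i> * of_real a)) = arctan (b - y)"
      by (subst Im_Ln_arctan) (auto simp: b_def)
    ultimately show ?thesis
      by (simp add: right_diff_distrib wxy) (simp add: algebra_simps)
  qed
  finally show ?thesis
    using arctan_kernel_nonneg[OF x1, of y b] by (simp add: A_def)
qed

section \<open>Positivity of the chord functional\<close>

lemma Re_Cayley_pos:
  fixes z :: complex
  assumes "norm z < 1"
  shows "0 < Re ((1 + z) / (1 - z))"
proof -
  have "1 - z \<noteq> 0" using assms by auto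
  moreover have "(Re z)\<^sup>2 + (Im z)\<^sup>2 < 1"
    using assms by (simp add: cmod_power2[symmetric] power_less_one_iff)
  ultimately show ?thesis unfolding Re_divide
    by (intro divide_pos_pos) (auto simp: power2_eq_square algebra_simps complex_eq_iff sum_power2_gt_zero_iff
        simp flip: power2_eq_square)
qed

lemma norm_Cayley_less_1:
  fixes v :: complex
  assumes "0 < Re v"
  shows "norm ((v - 1) / (v + 1)) < 1"
proof -
  have "v + 1 \<noteq> 0" using assms by (auto simp: complex_eq_iff)
  moreover have "(norm (v - 1))\<^sup>2 < (norm (v + 1))\<^sup>2"
    unfolding cmod_power2 using assms by (simp add: power2_eq_square algebra_simps)
  then have "norm (v - 1) < norm (v + 1)" by (simp add: power2_less_imp_less)
  ultimately show ?thesis by (simp add: norm_divide)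
qed

text \<open>The functional is real-linear, so the Schwarz formula writes it as the circle integral
  of Re f times its values on the kernels, both factors being nonnegative. The chord integral and
  the circle integral are exchanged by Fubini for a continuous integrand.\<close>

lemma chord_functional_disk:
  assumes w: "1 \<le> Re w" and f: "f holomorphic_on cball 0 1"
    and pos: "\<And>z. z \<in> cball 0 1 \<Longrightarrow> 0 \<le> Re (f z)"
  shows "0 \<le> chord_functional w (\<lambda>v. f ((v - 1) / (v + 1)))"
proof -
  define \<rho> where "\<rho> = (\<lambda>t. Re (f (cis (2 * pi * t))))"
  define Z where "Z = (\<lambda>v::complex. (v - 1) / (v + 1))"
  define K where "K = (\<lambda>t v. (cis (2 * pi * t) + Z v) / (cis (2 * pi * t) - Z v))"
  define S where "S = (\<lambda>s. 1 + of_real s * (w - 1))"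
  define c where "c = \<i> * of_real (Im (f 0))"
  define G where "G = (\<lambda>t v. of_real (\<rho> t) * K t v)"
  have Z1: "Z v \<in> ball 0 1" if "0 < Re v" for v
    using norm_Cayley_less_1[OF that] by (simp add: Z_def)
  have fcont: "continuous_on (cball 0 1) f" using f by (rule holomorphic_on_imp_continuous_on)
  have rho_cont: "continuous_on {0..1} \<rho>"
    unfolding \<rho>_def by (intro continuous_intros continuous_on_compose2[OF fcont]) auto
  have rep: "((\<lambda>t. G t v) has_integral f (Z v) - c) {0..1}" if "0 < Re v" for v
    using Schwarz_integral_formula[OF f Z1[OF that]] by (simp add: G_def K_def \<rho>_def c_def)
  have S0: "0 < Re (S s)" if "s \<in> {0..1}" for s using Re_chord_pos[OF w that] by (simp add: S_def)
  have S_cont: "continuous_on A S" for A unfolding S_def by (intro continuous_intros)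
  have Gc: "continuous_on ({0..1} \<times> {0..1}) (\<lambda>(t, s). G t (S s))"
  proof -
    have a: "S (snd x) + 1 \<noteq> 0" if "x \<in> {0..1::real} \<times> {0..1}" for x
    proof -
      have "0 < Re (S (snd x))" using S0[of "snd x"] that by auto
      then show ?thesis by (auto simp: complex_eq_iff)
    qed
    have b: "cis (2 * pi * fst x) - (S (snd x) - 1) / (S (snd x) + 1) \<noteq> 0" if "x \<in> {0..1} \<times> {0..1}" for x
    proof -
      have "norm (Z (S (snd x))) < 1" using Z1[OF S0[of "snd x"]] that by auto
      then show ?thesis unfolding Z_def by (metis eq_iff_diff_eq_0 norm_cis less_irrefl)
    qed
    have r: "continuous_on ({0..1} \<times> {0..1}) (\<lambda>x. \<rho> (fst x))"
      by (rule continuous_on_compose2[OF rho_cont]) (auto intro: continuous_intros)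
    have s: "continuous_on ({0..1} \<times> {0..1}) (\<lambda>x. S (snd x))"
      by (rule continuous_on_compose2[OF S_cont]) (auto intro: continuous_intros)
    show ?thesis
      unfolding case_prod_beta G_def K_def Z_def
      by (intro continuous_intros r s) (use a b in auto)
  qed
  have intG: "integral {0..1} (\<lambda>s. f (Z (S s))) - c = integral {0..1} (\<lambda>t. integral {0..1} (\<lambda>s. G t (S s)))"
  proof -
    have cont: "continuous_on {0..1} (\<lambda>s. f (Z (S s)))"
      unfolding Z_def
      by (intro continuous_on_compose2[OF fcont] continuous_intros S_cont)
         (use S0 Z1 in \<open>fastforce simp: Z_def complex_eq_iff\<close>)+
    have "integral {0..1} (\<lambda>t. integral {0..1} (\<lambda>s. G t (S s))) = integral {0..1} (\<lambda>s. integral {0..1} (\<lambda>t. G t (S s)))"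
      using integral_swap_continuous[of 0 0 1 1 "\<lambda>t s. G t (S s)"] Gc by (simp add: cbox_Pair_eq)
    also have "\<dots> = integral {0..1} (\<lambda>s. f (Z (S s)) - c)"
      by (rule integral_cong) (use rep S0 in \<open>auto intro!: integral_unique\<close>)
    also have "\<dots> = integral {0..1} (\<lambda>s. f (Z (S s))) - c"
      by (subst integral_diff) (use cont in \<open>auto intro: integrable_continuous_interval\<close>)
    finally show ?thesis by simp
  qed
  have w0: "0 < Re w" using w by simp
  have I1: "((\<lambda>t. G t w) has_integral f (Z w) - c) {0..1}" by (rule rep[OF w0])
  have cont2: "continuous_on {0..1} (\<lambda>t. integral {0..1} (\<lambda>s. G t (S s)))"
    using integral_continuous_on_param[of "{0..1}" 0 1 "\<lambda>t s. G t (S s)"] Gc by simp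
  have I2: "((\<lambda>t. integral {0..1} (\<lambda>s. G t (S s))) has_integral integral {0..1} (\<lambda>s. f (Z (S s))) - c) {0..1}"
    unfolding intG by (intro integrable_integral integrable_continuous_interval cont2)
  have L1: "bounded_linear (\<lambda>u. (Re w - 1) * Re (w * u))"
    by (intro bounded_linear_const_mult bounded_linear_compose[OF bounded_linear_Re] bounded_linear_mult_right)
  have L2: "bounded_linear (\<lambda>u. Im w * Im ((w - 1) * u))"
    by (intro bounded_linear_const_mult bounded_linear_compose[OF bounded_linear_Im] bounded_linear_mult_right)
  have I: "((\<lambda>t. (Re w - 1) * Re (w * G t w) + Im w * Im ((w - 1) * integral {0..1} (\<lambda>s. G t (S s)))) has_integral
      (Re w - 1) * Re (w * (f (Z w) - c)) + Im w * Im ((w - 1) * (integral {0..1} (\<lambda>s. f (Z (S s))) - c))) {0..1}"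
    using has_integral_add[OF has_integral_linear[OF I1 L1] has_integral_linear[OF I2 L2]] by (simp add: o_def)
  have eq: "(Re w - 1) * Re (w * G t w) + Im w * Im ((w - 1) * integral {0..1} (\<lambda>s. G t (S s)))
      = \<rho> t * chord_functional w (K t)" if "t \<in> {0..1}" for t
  proof -
    have "integral {0..1} (\<lambda>s. G t (S s)) = of_real (\<rho> t) * integral {0..1} (\<lambda>s. K t (S s))"
      unfolding G_def by simp
    then show ?thesis unfolding chord_functional_def S_def G_def
      by (simp add: algebra_simps)
  qed
  have nn: "0 \<le> \<rho> t * chord_functional w (K t)" if "t \<in> {0..1}" for t
  proof -
    have "0 \<le> chord_functional w (K t)"
      unfolding K_def Z_def by (rule chord_functional_kernel[OF w]) simp
    moreover have "0 \<le> \<rho> t" unfolding \<rho>_def by (rule pos) simp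
    ultimately show ?thesis by simp
  qed
  have "0 \<le> (Re w - 1) * Re (w * (f (Z w) - c)) + Im w * Im ((w - 1) * (integral {0..1} (\<lambda>s. f (Z (S s))) - c))"
    by (rule has_integral_nonneg[OF I]) (simp only: eq nn)
  \<comment> \<open>The constant \<open>c\<close> is purely imaginary and therefore drops
    out.\<close>
  also have "\<dots> = chord_functional w (\<lambda>v. f (Z v))"
    unfolding chord_functional_def S_def c_def by (simp add: algebra_simps)
  finally show ?thesis by (simp add: Z_def)
qed

text \<open>Boundary values of q are avoided by dilating its disk version to f(r z) with r < 1. The
  chord is a compact subset of the open half-plane, so the functional is continuous in r up to r =
  1.\<close>

lemma chord_functional_nonneg:
  assumes w: "1 \<le> Re w" and q: "q holomorphic_on {v. 0 < Re v}"
    and pos: "\<And>v. 0 < Re v \<Longrightarrow> 0 \<le> Re (q v)"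
  shows "0 \<le> chord_functional w q"
proof -
  define C where "C = (\<lambda>z::complex. (1 + z) / (1 - z))"
  define Z where "Z = (\<lambda>v::complex. (v - 1) / (v + 1))"
  define S where "S = (\<lambda>s. 1 + of_real s * (w - 1))"
  define f where "f = (\<lambda>z. q (C z))"
  have C0: "0 < Re (C z)" if "z \<in> ball 0 1" for z
    unfolding C_def by (rule Re_Cayley_pos) (use that in simp)
  have CZ: "C (Z v) = v" if "0 < Re v" for v
  proof -
    have "v + 1 \<noteq> 0" using that by (auto simp: complex_eq_iff)
    then have "1 + Z v = 2 * v / (v + 1)" "1 - Z v = 2 / (v + 1)"
      unfolding Z_def by (simp_all add: field_simps)
    then show ?thesis using \<open>v + 1 \<noteq> 0\<close> unfolding C_def by simp
  qed
  have Chol: "C holomorphic_on ball 0 1" unfolding C_def by (intro holomorphic_intros) auto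
  have fhol: "f holomorphic_on ball 0 1"
  proof -
    have "C ` ball 0 1 \<subseteq> {v. 0 < Re v}" using C0 by blast
    from holomorphic_on_compose_gen[OF Chol q this] show ?thesis by (simp add: f_def o_def)
  qed
  have fcont: "continuous_on (ball 0 1) f" using fhol by (rule holomorphic_on_imp_continuous_on)
  have Z1: "Z v \<in> ball 0 1" if "0 < Re v" for v
    using norm_Cayley_less_1[OF that] by (simp add: Z_def)
  have S0: "0 < Re (S s)" if "s \<in> {0..1}" for s using Re_chord_pos[OF w that] by (simp add: S_def)
  have S_cont: "continuous_on A S" for A unfolding S_def by (intro continuous_intros)
  define h where "h = (\<lambda>r. chord_functional w (\<lambda>v. f (of_real r * ((v - 1) / (v + 1)))))"
  have h0: "0 \<le> h r" if r: "r \<in> {0..<1}" for r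
  proof -
    have *: "of_real r * z \<in> ball 0 1" if "z \<in> cball 0 1" for z :: complex
    proof -
      have "norm (of_real r * z) \<le> r * 1" using that r by (simp add: norm_mult mult_left_le)
      then show ?thesis using r by simp
    qed
    have "(\<lambda>z. f (of_real r * z)) holomorphic_on cball 0 1"
    proof -
      have "(\<lambda>z::complex. of_real r * z) holomorphic_on cball 0 1" by (intro holomorphic_intros)
      moreover have "(\<lambda>z::complex. of_real r * z) ` cball 0 1 \<subseteq> ball 0 1" using * by blast
      ultimately show ?thesis using holomorphic_on_compose_gen[OF _ fhol] by (fastforce simp: o_def)
    qed
    then show ?thesis
      unfolding h_def by (rule chord_functional_disk[OF w, where f = "\<lambda>z. f (of_real r * z)"])
        (use * C0 pos in \<open>auto simp: f_def\<close>)
  qed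
  have rb: "of_real r * Z v \<in> ball 0 1" if "r \<in> {0..1}" "0 < Re v" for r v
  proof -
    have "norm (of_real r * Z v) \<le> norm (Z v)" using that by (simp add: norm_mult mult_left_le_one_le)
    then show ?thesis using Z1[OF that(2)] by simp
  qed
  have h_eq: "h = (\<lambda>r. (Re w - 1) * Re (w * f (of_real r * Z w)) +
      Im w * Im ((w - 1) * integral {0..1} (\<lambda>s. f (of_real r * Z (S s)))))"
    by (simp add: fun_eq_iff h_def chord_functional_def Z_def S_def)
  have hc: "continuous_on {0..1} h"
  proof -
    have w0: "0 < Re w" using w by simp
    have a: "S (snd x) + 1 \<noteq> 0" if "x \<in> {0..1::real} \<times> {0..1}" for x
    proof -
      have "0 < Re (S (snd x))" using S0[of "snd x"] that by auto
      then show ?thesis by (auto simp: complex_eq_iff)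
    qed
    have s: "continuous_on ({0..1::real} \<times> {0..1}) (\<lambda>x. S (snd x))"
      by (rule continuous_on_compose2[OF S_cont]) (auto intro: continuous_intros)
    have arg: "continuous_on ({0..1} \<times> {0..1}) (\<lambda>x. of_real (fst x) * Z (S (snd x)))"
      unfolding Z_def by (intro continuous_intros s) (use a in auto)
    have "continuous_on ({0..1} \<times> {0..1}) (\<lambda>x. f (of_real (fst x) * Z (S (snd x))))"
      by (rule continuous_on_compose2[OF fcont arg]) (use rb S0 in auto)
    then have "continuous_on {0..1} (\<lambda>r. integral {0..1} (\<lambda>s. f (of_real r * Z (S s))))"
      using integral_continuous_on_param[of "{0..1}" 0 1 "\<lambda>r s. f (of_real r * Z (S s))"]
      by (simp add: case_prod_beta)
    moreover have "continuous_on {0..1} (\<lambda>r. f (of_real r * Z w))"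
      by (intro continuous_on_compose2[OF fcont] continuous_intros) (use rb w0 in auto)
    moreover note h_eq
    ultimately show ?thesis by (simp only:) (intro continuous_intros)
  qed
  have "0 \<le> h 1"
  proof (rule tendsto_lowerbound)
    show "(h \<longlongrightarrow> h 1) (at 1 within {0..<1})"
    proof (rule tendsto_within_subset)
      show "(h \<longlongrightarrow> h 1) (at 1 within {0..1})" using hc by (simp add: continuous_on_def)
    qed auto
    show "\<forall>\<^sub>F r in at 1 within {0..<1}. 0 \<le> h r"
      using h0 by (auto simp: eventually_at_filter)
    show "at (1::real) within {0..<1} \<noteq> bot"
      by (simp add: at_within_eq_bot_iff)
  qed
  also have "h 1 = chord_functional w q"
  proof -
    have "integral {0..1} (\<lambda>s. f (Z (S s))) = integral {0..1} (\<lambda>s. q (S s))"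
      by (rule integral_cong) (use CZ S0 in \<open>auto simp: f_def\<close>)
    then have "h 1 = (Re w - 1) * Re (w * q w) + Im w * Im ((w - 1) * integral {0..1} (\<lambda>s. q (S s)))"
      using CZ[of w] w unfolding h_eq by (simp add: f_def)
    then show ?thesis by (simp only: chord_functional_def S_def)
  qed
  finally show ?thesis .
qed

section \<open>Koenigs functions on the right half-plane\<close>

abbreviation right_half_plane :: "complex set" where
  "right_half_plane \<equiv> {w. 0 < Re w}"

lemma open_right_half_plane: "open right_half_plane"
  by (rule open_halfspace_Re_gt)

lemma convex_right_half_plane: "convex right_half_plane"
  by (rule convex_halfspace_Re_gt)

text \<open>Minimum principle for Re q by the open mapping theorem; it settles the degenerate case
  of an orbit whose real part does not grow.\<close>

lemma constant_of_Re_eq_0: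
  assumes q: "q holomorphic_on S" and S: "open S" "connected S"
    and pos: "\<And>v. v \<in> S \<Longrightarrow> 0 \<le> Re (q v)" and a: "a \<in> S" "Re (q a) = 0" and v: "v \<in> S"
  shows "q v = q a"
proof (rule ccontr)
  assume "q v \<noteq> q a"
  then have "\<not> q constant_on S" using a v by (metis constant_on_def)
  then have "open (q ` S)" using open_mapping_thm[OF q S S(1)] by simp
  then obtain e where e: "0 < e" "ball (q a) e \<subseteq> q ` S"
    using a by (meson imageI open_contains_ball)
  have "q a - of_real (e / 2) \<in> ball (q a) e" using e by (simp add: dist_norm)
  then obtain u where "u \<in> S" "q u = q a - of_real (e / 2)"
    using e by (metis (no_types, lifting) imageE subsetD)
  then have "Re (q u) < 0" using a e by simp
  then show False using pos[OF \<open>u \<in> S\<close>] by simp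
qed

text \<open>\<open>shift\<close> carries the whole semigroup: by injectivity v is the image of w at
  time t. Its inequality is Julia's lemma with the Denjoy-Wolff point at infinity, built in so that
  neither the disk nor that point has to appear here.\<close>

locale half_plane_Koenigs =
  fixes k :: "complex \<Rightarrow> complex"
  assumes holo: "k holomorphic_on right_half_plane"
    and inj: "inj_on k right_half_plane"
    and k_1: "k 1 = 0"
    and shift: "\<And>w t. 0 < Re w \<Longrightarrow> 0 \<le> t \<Longrightarrow> \<exists>v. Re w \<le> Re v \<and> k v = k w + of_real t"
begin

definition k_inv :: "complex \<Rightarrow> complex" where
  "k_inv = inv_into right_half_plane k"

definition orbit :: "real \<Rightarrow> complex" where
  "orbit t = k_inv (of_real t)"

lemma k_inv_k: "0 < Re w \<Longrightarrow> k_inv (k w) = w"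
  by (simp add: k_inv_def inv_into_f_f[OF inj])

lemma open_image: "open (k ` right_half_plane)"
  by (rule open_mapping_thm3[OF holo open_right_half_plane inj])

lemma holo_k_inv: "k_inv holomorphic_on k ` right_half_plane"
  and deriv_k_inv: "0 < Re w \<Longrightarrow> deriv k w * deriv k_inv (k w) = 1"
proof -
  obtain g where g: "g holomorphic_on k ` right_half_plane"
    "\<And>z. z \<in> right_half_plane \<Longrightarrow> deriv k z * deriv g (k z) = 1"
    "\<And>z. z \<in> right_half_plane \<Longrightarrow> g (k z) = z"
    using holomorphic_has_inverse[OF holo open_right_half_plane inj] by metis
  have eq: "g u = k_inv u" if "u \<in> k ` right_half_plane" for u
    using that g(3) k_inv_k by auto
  show "k_inv holomorphic_on k ` right_half_plane"
    using g(1) eq by (simp cong: holomorphic_cong)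
  have "deriv g u = deriv k_inv u" if "u \<in> k ` right_half_plane" for u
    by (rule deriv_cong_ev) (use eq open_image that in \<open>auto intro: eventually_mono[OF eventually_nhds_in_open]\<close>)
  then show "deriv k w * deriv k_inv (k w) = 1" if "0 < Re w"
    using g(2)[of w] that by auto
qed

lemma shift_obtains:
  assumes "0 < Re w" "0 \<le> t"
  shows "Re w \<le> Re (k_inv (k w + of_real t))" "k (k_inv (k w + of_real t)) = k w + of_real t"
    "k w + of_real t \<in> k ` right_half_plane"
proof -
  obtain v where v: "Re w \<le> Re v" "k v = k w + of_real t" using shift[OF assms] by blast
  then have "k_inv (k w + of_real t) = v" using k_inv_k[of v] assms by simp
  then show "Re w \<le> Re (k_inv (k w + of_real t))" "k (k_inv (k w + of_real t)) = k w + of_real t"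
    using v by auto
  have "v \<in> right_half_plane" using v assms by simp
  then show "k w + of_real t \<in> k ` right_half_plane" unfolding v(2)[symmetric] by (rule imageI)
qed

lemma has_field_derivative_k: "0 < Re w \<Longrightarrow> (k has_field_derivative deriv k w) (at w)"
  using holomorphic_derivI[OF holo open_right_half_plane] by simp

lemma has_field_derivative_k_inv:
  "u \<in> k ` right_half_plane \<Longrightarrow> (k_inv has_field_derivative deriv k_inv u) (at u)"
  using holomorphic_derivI[OF holo_k_inv open_image] by simp

lemma deriv_k_inv_eq: "0 < Re w \<Longrightarrow> deriv k_inv (k w) = inverse (deriv k w)"
  using deriv_k_inv[of w] by (metis inverse_unique)

lemma deriv_k_nz: "0 < Re w \<Longrightarrow> deriv k w \<noteq> 0"
  using deriv_k_inv[of w] by auto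

text \<open>The flow through w has velocity 1 / k'(w) at time 0 and cannot lower the real part;
  taking reciprocals keeps the sign of the real part.\<close>

lemma Re_deriv_nonneg:
  assumes w: "0 < Re w"
  shows "0 \<le> Re (deriv k w)"
proof -
  define F where "F = (\<lambda>t. k_inv (k w + of_real t))"
  have "((\<lambda>t. k w + of_real t) has_vector_derivative 1) (at 0)"
    by (auto intro!: derivative_eq_intros has_vector_derivative_real_field simp: has_vector_derivative_def scaleR_conv_of_real)
  moreover have "(k_inv has_field_derivative deriv k_inv (k w)) (at (k w + of_real 0))"
    using has_field_derivative_k_inv[of "k w"] w by simp
  ultimately have "(F has_vector_derivative 1 * deriv k_inv (k w)) (at 0)"
    using field_vector_diff_chain_at[of "\<lambda>t. k w + of_real t" 1 0 k_inv] by (simp add: F_def o_def)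
  then have "((\<lambda>t. Re (F t)) has_vector_derivative Re (deriv k_inv (k w))) (at 0)"
    using bounded_linear.has_vector_derivative[OF bounded_linear_Re] by simp
  then have "((\<lambda>t. Re (F t)) has_real_derivative Re (deriv k_inv (k w))) (at 0)"
    by (simp add: has_real_derivative_iff_has_vector_derivative)
  then have "((\<lambda>t. (Re (F t) - Re (F 0)) / (t - 0)) \<longlongrightarrow> Re (deriv k_inv (k w))) (at 0)"
    by (simp add: has_field_derivative_iff)
  \<comment> \<open>The monotonicity of the real part is available for t \<ge> 0 only, hence the
    one-sided limit.\<close>
  then have lim: "((\<lambda>t. (Re (F t) - Re (F 0)) / (t - 0)) \<longlongrightarrow> Re (deriv k_inv (k w))) (at_right 0)"
    by (rule filterlim_mono) (auto simp: at_le)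
  have "0 \<le> Re (deriv k_inv (k w))"
  proof (rule tendsto_lowerbound[OF lim])
    have "F 0 = w" using k_inv_k[OF w] by (simp add: F_def)
    then show "\<forall>\<^sub>F t in at_right 0. 0 \<le> (Re (F t) - Re (F 0)) / (t - 0)"
      using shift_obtains(1)[OF w] by (auto simp: F_def eventually_at_filter)
  qed simp
  then show ?thesis
    unfolding deriv_k_inv_eq[OF w] by (simp add: inverse_complex.sel zero_le_divide_iff sum_power2_ge_zero)
      (metis deriv_k_nz[OF w] complex_eq_iff not_sum_power2_lt_zero sum_power2_eq_zero_iff zero_complex.sel order_le_less)
qed

lemma orbit_0: "orbit 0 = 1"
  using k_inv_k[of 1] k_1 by (simp add: orbit_def)

lemma k_orbit: "0 \<le> t \<Longrightarrow> k (orbit t) = of_real t"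
  using shift_obtains(2)[of 1 t] k_1 by (simp add: orbit_def)

lemma orbit_eqI: "0 < Re w \<Longrightarrow> k w = of_real t \<Longrightarrow> w = orbit t"
  using k_inv_k[of w] by (simp add: orbit_def)

lemma Re_orbit_ge_1: "0 \<le> t \<Longrightarrow> 1 \<le> Re (orbit t)"
  using shift_obtains(1)[of 1 t] k_1 by (simp add: orbit_def)

lemma Re_orbit_pos: "0 \<le> t \<Longrightarrow> 0 < Re (orbit t)"
  using Re_orbit_ge_1[of t] by simp

lemma Re_orbit_mono:
  assumes "0 \<le> s" "s \<le> t"
  shows "Re (orbit s) \<le> Re (orbit t)"
proof -
  have "k (orbit s) + of_real (t - s) = of_real t" using assms by (simp add: k_orbit)
  then show ?thesis
    using shift_obtains(1)[OF Re_orbit_pos[OF assms(1)], of "t - s"] assms by (simp add: orbit_def)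
qed

lemma orbit_has_vector_derivative:
  assumes "0 \<le> t"
  shows "(orbit has_vector_derivative inverse (deriv k (orbit t))) (at t)"
proof -
  have "of_real t \<in> k ` right_half_plane"
    using k_orbit[OF assms] Re_orbit_pos[OF assms] by (metis image_eqI mem_Collect_eq)
  then have "(k_inv has_field_derivative deriv k_inv (of_real t)) (at (of_real t))"
    by (rule has_field_derivative_k_inv)
  then have "((\<lambda>t. k_inv (of_real t)) has_vector_derivative deriv k_inv (of_real t)) (at t)"
    by (rule has_vector_derivative_real_field)
  moreover have "deriv k_inv (of_real t) = inverse (deriv k (orbit t))"
    using deriv_k_inv_eq[OF Re_orbit_pos[OF assms]] k_orbit[OF assms] by simp
  ultimately show ?thesis by (simp add: orbit_def[abs_def])
qed

lemma Re_orbit_deriv: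
  "0 \<le> t \<Longrightarrow> ((\<lambda>t. Re (orbit t)) has_real_derivative Re (inverse (deriv k (orbit t)))) (at t)"
  "0 \<le> t \<Longrightarrow> ((\<lambda>t. Im (orbit t)) has_real_derivative Im (inverse (deriv k (orbit t)))) (at t)"
  using bounded_linear.has_vector_derivative[OF bounded_linear_Re orbit_has_vector_derivative]
    bounded_linear.has_vector_derivative[OF bounded_linear_Im orbit_has_vector_derivative]
  by (simp_all add: has_real_derivative_iff_has_vector_derivative)

text \<open>On the orbit the chord integral of \<open>k'\<close> is the real number \<open>t\<close>, so the second term of
  \<^const>\<open>chord_functional\<close> disappears.\<close>

lemma Re_orbit_mult_deriv_nonneg:
  assumes t: "0 \<le> t"
  shows "0 \<le> Re (orbit t * deriv k (orbit t))"
proof -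
  define w where "w = orbit t"
  have w1: "1 \<le> Re w" using Re_orbit_ge_1[OF t] by (simp add: w_def)
  have int: "(w - 1) * integral {0..1} (\<lambda>s. deriv k (1 + of_real s * (w - 1))) = of_real t"
    using chord_integral[OF w1, of k "deriv k"] has_field_derivative_k k_1 k_orbit[OF t] by (simp add: w_def)
  have dhol: "deriv k holomorphic_on right_half_plane"
    by (rule holomorphic_deriv[OF holo open_right_half_plane])
  consider "1 < Re w" | "t = 0" | "Re w = 1" "0 < t" using w1 t by linarith
  then have "0 \<le> Re (w * deriv k w)"
  proof cases
    case 1
    have "0 \<le> chord_functional w (deriv k)"
      by (rule chord_functional_nonneg[OF w1 dhol Re_deriv_nonneg])
    then have "0 \<le> (Re w - 1) * Re (w * deriv k w)"
      unfolding chord_functional_def int by simp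
    then show ?thesis using 1 by (simp add: zero_le_mult_iff)
  next
    case 2
    then show ?thesis using Re_deriv_nonneg[of 1] by (simp add: w_def orbit_0)
  next
    \<comment> \<open>At Re w = 1 the first term of the functional vanishes and gives no
      information. But then the real part has not grown between times 0 and t, so some velocity on
      the orbit is purely imaginary and k' is an imaginary constant. The chord integral yields w k'
      = t + k', of real part t.\<close>
    case 3
    obtain z where z: "0 < z" "z < t"
      "Re (orbit t) - Re (orbit 0) = (t - 0) * Re (inverse (deriv k (orbit z)))"
      using MVT2[OF 3(2), of "\<lambda>t. Re (orbit t)" "\<lambda>t. Re (inverse (deriv k (orbit t)))"] Re_orbit_deriv(1) by auto
    define a where "a = orbit z"
    have a0: "0 < Re a" using Re_orbit_pos[of z] z by (simp add: a_def)
    have "Re (inverse (deriv k a)) = 0" using z 3 by (simp add: w_def orbit_0 a_def)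
    then have a1: "Re (deriv k a) = 0" using deriv_k_nz[OF a0] by (auto simp: complex_eq_iff)
    have c: "deriv k v = deriv k a" if "0 < Re v" for v
      by (rule constant_of_Re_eq_0[OF dhol open_right_half_plane convex_connected[OF convex_right_half_plane]])
        (use Re_deriv_nonneg a0 a1 that in auto)
    have "integral {0..1} (\<lambda>s. deriv k (1 + of_real s * (w - 1))) = integral {0..1} (\<lambda>s::real. deriv k a)"
      by (rule integral_cong) (use c Re_chord_pos[OF w1] in blast)
    then have "(w - 1) * deriv k a = of_real t" using int by simp
    then have "w * deriv k w = of_real t + deriv k a"
      using c[of w] w1 by (simp add: algebra_simps)
    then show ?thesis using \<open>Re (deriv k a) = 0\<close> t by simp
  qed
  then show ?thesis by (simp add: w_def)
qed

text \<open>With q = k'(w), the derivative of |w|^2 along the orbit is 2 Re (cnj w / q) = 2 Re (w q)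
  / |q|^2.\<close>

lemma norm_orbit_mono:
  assumes "0 \<le> s" "s \<le> t"
  shows "norm (orbit s) \<le> norm (orbit t)"
proof -
  define f where "f = (\<lambda>t. (Re (orbit t))\<^sup>2 + (Im (orbit t))\<^sup>2)"
  have "f s \<le> f t"
  proof (rule DERIV_nonneg_imp_nondecreasing[OF assms(2)])
    fix u assume u: "s \<le> u" "u \<le> t"
    then have u0: "0 \<le> u" using assms by simp
    define w q where "w = orbit u" and "q = deriv k w"
    define d where "d = inverse q"
    have "(f has_real_derivative 2 * (Re w * Re d + Im w * Im d)) (at u)"
      unfolding f_def w_def q_def d_def
      by (rule derivative_eq_intros Re_orbit_deriv[OF u0] refl)+ (simp add: algebra_simps)
    moreover have "Re w * Re d + Im w * Im d = Re (w * q) / ((Re q)\<^sup>2 + (Im q)\<^sup>2)"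
      by (simp add: d_def diff_divide_distrib)
    moreover have "0 \<le> Re (w * q)" using Re_orbit_mult_deriv_nonneg[OF u0] by (simp add: w_def q_def)
    ultimately show "\<exists>y. (f has_real_derivative y) (at u) \<and> 0 \<le> y"
      by (metis divide_nonneg_nonneg mult_nonneg_nonneg sum_power2_ge_zero zero_le_numeral)
  qed
  then show ?thesis by (simp add: f_def cmod_def)
qed

end

section \<open>Comparison of harmonic measures\<close>

text \<open>Compactness of the negative sublevel sets expresses that Re F has nonnegative lower
  limits at the boundary and at infinity, without naming boundary values. On the frontier of such a
  set Re F is not below c, so the maximum modulus principle for exp (- F) applies.\<close>

lemma Re_nonneg_if_sublevel_compact:
  assumes V: "open V" and F: "F holomorphic_on V"
    and cpt: "\<And>c. c < 0 \<Longrightarrow> compact {v \<in> V. Re (F v) \<le> c}" and v: "v \<in> V"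
  shows "0 \<le> Re (F v)"
proof (rule ccontr)
  assume neg: "\<not> 0 \<le> Re (F v)"
  \<comment> \<open>Strictly between \<open>Re (F v)\<close> and 0: v then lies in the sublevel set,
    and the resulting bound c \<le> Re (F v) is absurd.\<close>
  define c where "c = Re (F v) / 2"
  define K where "K = {v \<in> V. Re (F v) \<le> c}"
  have K: "compact K" unfolding K_def by (rule cpt) (use neg in \<open>simp add: c_def\<close>)
  have KV: "K \<subseteq> V" by (auto simp: K_def)
  have cl: "closure K = K" using K by (simp add: compact_imp_closed)
  have hol: "(\<lambda>v. exp (- F v)) holomorphic_on V" by (intro holomorphic_intros F)
  have cont: "continuous_on V (\<lambda>v. Re (F v))"
    using holomorphic_on_imp_continuous_on[OF F] by (intro continuous_intros)
  have "norm (exp (- F v)) \<le> exp (- c)"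
  proof (rule maximum_modulus_frontier[where f = "\<lambda>v. exp (- F v)" and S = K])
    show "(\<lambda>v. exp (- F v)) holomorphic_on interior K"
      by (rule holomorphic_on_subset[OF hol]) (use KV interior_subset in blast)
    show "continuous_on (closure K) (\<lambda>v. exp (- F v))"
      unfolding cl using holomorphic_on_imp_continuous_on[OF hol] KV by (rule continuous_on_subset)
    show "bounded K" using K by (rule compact_imp_bounded)
    show "v \<in> K" using v neg by (simp add: K_def c_def)
    fix p assume p: "p \<in> frontier K"
    then have pK: "p \<in> K" "p \<notin> interior K" using cl by (auto simp: frontier_def)
    have "\<not> Re (F p) < c"
    proof
      assume less: "Re (F p) < c"
      have "open (V \<inter> (\<lambda>v. Re (F v)) -` {..<c})"
        using continuous_open_preimage[OF cont V, of "{..<c}"] by simp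
      moreover have "V \<inter> (\<lambda>v. Re (F v)) -` {..<c} \<subseteq> K" by (auto simp: K_def)
      ultimately have "p \<in> interior K" using less pK KV by (intro interiorI) auto
      then show False using pK by simp
    qed
    then show "norm (exp (- F p)) \<le> exp (- c)" by (simp add: norm_exp_eq_Re)
  qed
  then have "c \<le> Re (F v)" by (simp add: norm_exp_eq_Re)
  then show False using neg by (simp add: c_def)
qed

text \<open>Thales: the two quotients are reciprocal because x^2 = (R - y) (R + y). This gives the
  boundary value on the half circle of the function \<open>u\<close> in
  \<open>orbit_comparison\<close>.\<close>

lemma arctan_sum_quarter:
  fixes x y R :: real
  assumes x: "0 < x" and R: "x\<^sup>2 + y\<^sup>2 = R\<^sup>2" "0 < R"
  shows "arctan (x / (R - y)) + arctan (x / (R + y)) = pi / 2"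
proof -
  have "y\<^sup>2 < R\<^sup>2" using x R by (smt (verit) zero_less_power)
  then have y: "\<bar>y\<bar> < R" using R power2_less_imp_less[of "\<bar>y\<bar>" R] by simp
  then have p: "0 < R - y" "0 < R + y" by auto
  have "x / (R + y) = inverse (x / (R - y))"
  proof -
    have "x * x = (R - y) * (R + y)" using R by (simp add: power2_eq_square algebra_simps)
    then show ?thesis using p x by (simp add: field_simps)
  qed
  then show ?thesis using arctan_inverse[of "x / (R - y)"] x p by simp
qed

context half_plane_Koenigs
begin

text \<open>The complement of the tail of the orbit, since k is injective and sends
  \<open>orbit s\<close> to s. Described by values of k, it is exactly where t - k w avoids the cut
  of the principal root.\<close>

definition slit_domain :: "real \<Rightarrow> complex set" where
  "slit_domain t = {w. 0 < Re w \<and> k w \<notin> of_real ` {t..}}"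

lemma strip_subset_slit_domain:
  assumes "0 \<le> t" "0 < Re w" "Re w < Re (orbit t)"
  shows "w \<in> slit_domain t"
proof -
  have False if "k w = of_real s" "t \<le> s" for s
    using orbit_eqI[OF assms(2) that(1)] Re_orbit_mono[OF assms(1) that(2)] assms by simp
  then show ?thesis using assms by (auto simp: slit_domain_def)
qed

text \<open>Since \<open>k\<close> straightens the tail of the orbit to \<open>[t,\<infinity>)\<close>, the branch is explicit: the principal
  root of \<open>t - k w\<close> corrected by a root of a zero-free function on the whole half-plane.\<close>

lemma slit_sqrt:
  assumes t: "0 \<le> t"
  obtains s where "s holomorphic_on slit_domain t"
    "\<And>w. w \<in> slit_domain t \<Longrightarrow> (s w)\<^sup>2 = (w - orbit t) / (w + cnj (orbit t))"
proof -
  define a where "a = orbit t"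
  have a: "0 < Re a" using Re_orbit_pos[OF t] by (simp add: a_def)
  \<comment> \<open>Difference quotient of k at the tip, zero-free because k is injective. It trades
    the factor w - a for k w - t, whose slit is straight.\<close>
  define P where "P = (\<lambda>w. if w = a then deriv k a else (k w - k a) / (w - a))"
  have P: "P holomorphic_on right_half_plane"
    unfolding P_def by (rule pole_lemma_open[OF holo open_right_half_plane])
  have P0: "P w \<noteq> 0" if "0 < Re w" for w
    using deriv_k_nz[OF a] inj that a by (auto simp: P_def inj_on_def)
  have wa: "w + cnj a \<noteq> 0" if "0 < Re w" for w using that a by (auto simp: complex_eq_iff)
  have "(\<lambda>w. - 1 / (P w * (w + cnj a))) holomorphic_on right_half_plane"
    by (intro holomorphic_intros P) (use P0 wa in auto)
  then obtain m where m: "m holomorphic_on right_half_plane"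
    "\<And>w. w \<in> right_half_plane \<Longrightarrow> - 1 / (P w * (w + cnj a)) = (m w)\<^sup>2"
    using contractible_imp_holomorphic_sqrt[OF _ convex_imp_contractible[OF convex_right_half_plane]]
      P0 wa by (metis (no_types, lifting) divide_eq_0_iff mem_Collect_eq mult_eq_0_iff neg_equal_0_iff_equal zero_neq_one)
  show thesis
  proof
    show "(\<lambda>w. csqrt (of_real t - k w) * m w) holomorphic_on slit_domain t"
    proof (intro holomorphic_intros)
      show "k holomorphic_on slit_domain t" "m holomorphic_on slit_domain t"
        by (auto intro: holomorphic_on_subset[OF holo] holomorphic_on_subset[OF m(1)] simp: slit_domain_def)
      fix w assume "w \<in> slit_domain t"
      then have *: "k w \<notin> of_real ` {t..}" by (simp add: slit_domain_def)
      show "of_real t - k w \<notin> \<real>\<^sub>\<le>\<^sub>0"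
      proof
        assume "of_real t - k w \<in> \<real>\<^sub>\<le>\<^sub>0"
        then have "k w = of_real (Re (k w))" "t \<le> Re (k w)"
          by (auto simp: complex_nonpos_Reals_iff complex_eq_iff)
        then show False using * by (metis atLeast_iff image_eqI)
      qed
    qed
    fix w assume w: "w \<in> slit_domain t"
    then have w0: "0 < Re w" by (simp add: slit_domain_def)
    have "w \<noteq> a" using w k_orbit[OF t] by (auto simp: slit_domain_def a_def)
    then have "k w - k a \<noteq> 0" using inj w0 a by (auto simp: inj_on_def)
    have "(csqrt (of_real t - k w) * m w)\<^sup>2 = (of_real t - k w) * (- 1 / (P w * (w + cnj a)))"
      using m(2)[of w] w0 by (simp add: power_mult_distrib)
    also have "\<dots> = (w - a) / (w + cnj a)"
      using \<open>w \<noteq> a\<close> \<open>k w - k a \<noteq> 0\<close> wa[OF w0] k_orbit[OF t]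
      by (simp add: P_def a_def divide_simps) (simp add: algebra_simps)
    finally show "(csqrt (of_real t - k w) * m w)\<^sup>2 = (w - orbit t) / (w + cnj (orbit t))"
      by (simp add: a_def)
  qed
qed

text \<open>\<open>\<kappa>\<close> is a Cayley transform of that root. With \<open>a = Re (orbit t)\<close>, the harmonic function
  \<open>1/2 - Arg \<kappa> / \<pi>\<close> takes values in \<open>[0,1]\<close> and vanishes on the imaginary axis, because \<open>\<kappa>\<close> keeps
  to the upper half-plane on the strip \<open>0 < Re w < a\<close>: it is the lower bound for the harmonic
  measure of the tail of the orbit.\<close>

lemma slit_map:
  assumes t: "0 \<le> t"
  obtains \<kappa> where "\<kappa> holomorphic_on slit_domain t"
    "\<And>w. w \<in> slit_domain t \<Longrightarrow> 0 < Re (\<kappa> w)"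
    "\<And>w. w \<in> slit_domain t \<Longrightarrow> \<kappa> w + 1 / \<kappa> w = 2 * (w - \<i> * of_real (Im (orbit t))) / of_real (Re (orbit t))"
    "\<And>w. 0 < Re w \<Longrightarrow> Re w < Re (orbit t) \<Longrightarrow> 0 < Im (\<kappa> w)"
proof -
  define a where "a = orbit t"
  have a: "0 < Re a" using Re_orbit_pos[OF t] by (simp add: a_def)
  obtain s where s: "s holomorphic_on slit_domain t"
    "\<And>w. w \<in> slit_domain t \<Longrightarrow> (s w)\<^sup>2 = (w - a) / (w + cnj a)"
    using slit_sqrt[OF t] unfolding a_def by blast
  have s1: "norm (s w) < 1" if "w \<in> slit_domain t" for w
  proof -
    have w0: "0 < Re w" using that by (simp add: slit_domain_def)
    have wa: "w + cnj a \<noteq> 0" using w0 a by (auto simp: complex_eq_iff)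
    have "(norm (w - a))\<^sup>2 < (norm (w + cnj a))\<^sup>2"
      unfolding cmod_power2 using mult_pos_pos[OF w0 a] by (simp add: power2_eq_square algebra_simps)
    then have "norm (w - a) < norm (w + cnj a)" by (simp add: power2_less_imp_less)
    then have "(norm (s w))\<^sup>2 < 1"
      using s(2)[OF that] wa by (metis norm_power norm_divide divide_less_eq_1_pos zero_less_norm_iff)
    then show ?thesis by (simp add: power_less_one_iff)
  qed
  then have s0: "1 - s w \<noteq> 0" "1 + s w \<noteq> 0" if "w \<in> slit_domain t" for w
    using s1[OF that] by (auto simp: add_eq_0_iff)
  define \<kappa> where "\<kappa> = (\<lambda>w. (1 + s w) / (1 - s w))"
  have hol: "\<kappa> holomorphic_on slit_domain t"
    unfolding \<kappa>_def by (intro holomorphic_intros s) (use s0 in auto)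
  have pos: "0 < Re (\<kappa> w)" if "w \<in> slit_domain t" for w
    unfolding \<kappa>_def by (rule Re_Cayley_pos[OF s1[OF that]])
  have nz: "\<kappa> w \<noteq> 0" if "w \<in> slit_domain t" for w using pos[OF that] by auto
  have eq: "\<kappa> w + 1 / \<kappa> w = 2 * (w - \<i> * of_real (Im a)) / of_real (Re a)" if "w \<in> slit_domain t" for w
  proof -
    have w0: "0 < Re w" using that by (simp add: slit_domain_def)
    have wa: "w + cnj a \<noteq> 0" using w0 a by (auto simp: complex_eq_iff)
    have aa: "of_real (Re a) \<noteq> (0::complex)" using a by simp
    have c: "a + cnj a = 2 * of_real (Re a)" "a - cnj a = 2 * \<i> * of_real (Im a)"
      by (simp_all add: complex_eq_iff)
    have "s w * s w \<noteq> 1" using s0[OF that] by (auto simp: square_eq_1_iff)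
    then have "\<kappa> w + 1 / \<kappa> w = 2 * (1 + (s w)\<^sup>2) / (1 - (s w)\<^sup>2)"
      using s0[OF that] unfolding \<kappa>_def by (simp add: divide_simps power2_eq_square) (simp add: algebra_simps)
    also have "1 + (s w)\<^sup>2 = 2 * (w - \<i> * of_real (Im a)) / (w + cnj a)"
      unfolding s(2)[OF that] using wa c(2) by (simp add: field_simps)
    also have "1 - (s w)\<^sup>2 = 2 * of_real (Re a) / (w + cnj a)"
      unfolding s(2)[OF that] using wa c(1) by (simp add: field_simps)
    also have "2 * (2 * (w - \<i> * of_real (Im a)) / (w + cnj a)) / (2 * of_real (Re a) / (w + cnj a))
        = 2 * (w - \<i> * of_real (Im a)) / of_real (Re a)"
    proof -
      have "2 * (2 * X / D) / (2 * r / D) = 2 * X / r" if "D \<noteq> 0" "r \<noteq> 0" for X D r :: complex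
        using that by (simp add: field_simps)
      from this[OF wa aa] show ?thesis .
    qed
    finally show ?thesis .
  qed
  define T where "T = {w. 0 < Re w \<and> Re w < Re a}"
  have T: "T \<subseteq> slit_domain t" using strip_subset_slit_domain[OF t] by (auto simp: T_def a_def)
  \<comment> \<open>A positive real \<kappa> would give \<kappa> + 1 / \<kappa> \<ge> 2, whereas on
    the strip the real part of this sum is 2 Re w / Re a < 2. Hence Im \<kappa> keeps one sign on
    the connected strip.\<close>
  have nzT: "Im (\<kappa> w) \<noteq> 0" if "w \<in> T" for w
  proof
    assume im: "Im (\<kappa> w) = 0"
    define r where "r = Re (\<kappa> w)"
    have kr: "\<kappa> w = of_real r" using im by (simp add: r_def complex_eq_iff)
    have r: "0 < r" using pos T that by (auto simp: r_def)
    have "Re (2 * (w - \<i> * of_real (Im a)) / of_real (Re a)) = r + 1 / r"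
      using eq[of w] T that unfolding kr by (metis of_real_1 of_real_add of_real_divide Re_complex_of_real subsetD)
    then have "2 * Re w / Re a = r + 1 / r" by simp
    moreover have "2 * Re w / Re a < 2" using that a by (simp add: T_def divide_less_eq)
    moreover have "2 \<le> r + 1 / r"
    proof -
      have "2 * r \<le> r * r + 1" using zero_le_power2[of "r - 1"] by (simp add: power2_eq_square algebra_simps)
      then show ?thesis using r by (simp add: field_simps)
    qed
    ultimately show False by simp
  qed
  have convT: "convex T"
  proof -
    have "T = {w. Re w > 0} \<inter> {w. Re w < Re a}" by (auto simp: T_def)
    then show ?thesis by (simp add: convex_Int convex_halfspace_Re_gt convex_halfspace_Re_lt)
  qed
  have contT: "continuous_on T (\<lambda>w. Im (\<kappa> w))"
    using continuous_on_subset[OF holomorphic_on_imp_continuous_on[OF hol] T] by (intro continuous_intros)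
  have "connected ((\<lambda>w. Im (\<kappa> w)) ` T)"
    by (rule connected_continuous_image[OF contT convex_connected[OF convT]])
  then have iv: "is_interval ((\<lambda>w. Im (\<kappa> w)) ` T)" by (simp add: is_interval_connected_1)
  have zero: "0 \<notin> (\<lambda>w. Im (\<kappa> w)) ` T" using nzT by auto
  have same: "\<not> (Im (\<kappa> u) < 0 \<and> 0 < Im (\<kappa> v))" if "u \<in> T" "v \<in> T" for u v
    using mem_is_interval_1_I[OF iv, of "Im (\<kappa> u)" "Im (\<kappa> v)" 0] zero that by auto
  have "(\<forall>w\<in>T. 0 < Im (\<kappa> w)) \<or> (\<forall>w\<in>T. Im (\<kappa> w) < 0)"
    using same nzT by (meson linorder_neqE_linordered_idom)
  then show thesis
  proof
    assume "\<forall>w\<in>T. 0 < Im (\<kappa> w)"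
    then show thesis using that[of \<kappa>] hol pos eq by (auto simp: T_def a_def)
  next
    \<comment> \<open>The root was taken with the wrong sign. Replacing s by - s replaces \<kappa>
      by 1 / \<kappa>, which preserves the equation and the half-plane and flips the sign of the
      imaginary part.\<close>
    assume neg: "\<forall>w\<in>T. Im (\<kappa> w) < 0"
    have "(\<lambda>w. 1 / \<kappa> w) holomorphic_on slit_domain t"
      by (intro holomorphic_intros hol) (use nz in auto)
    moreover have "0 < Re (1 / \<kappa> w)" if "w \<in> slit_domain t" for w
      using pos[OF that] by (simp add: Re_divide add_pos_nonneg)
    moreover have "1 / \<kappa> w + 1 / (1 / \<kappa> w) = 2 * (w - \<i> * of_real (Im a)) / of_real (Re a)"
      if "w \<in> slit_domain t" for w
      using eq[OF that] by (simp add: add.commute)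
    moreover have "0 < Im (1 / \<kappa> w)" if "0 < Re w" "Re w < Re a" for w
    proof -
      have "Im (\<kappa> w) < 0" using neg that by (simp add: T_def)
      then show ?thesis by (simp add: Im_divide divide_neg_pos sum_power2_gt_zero_iff)
    qed
    ultimately show thesis using that[of "\<lambda>w. 1 / \<kappa> w"] by (simp add: a_def)
  qed
qed

end

text \<open>Bounds Arg \<kappa> at the base point w = 1, with x + i y the tip of the tail. For p = 1
  + 1/n and q = 1 - 1/n, the real and imaginary parts read a p x = 2 and b q = - a p y. As p^2 - q^2
  = 4 / n and b^2 <= n, it follows that (b p)^2 <= (b q)^2 + 4 = (a p)^2 (x^2 + y^2).\<close>

lemma Joukowski_slope_le:
  fixes \<kappa> :: complex
  assumes "0 < Re \<kappa>" "0 < x" and eq: "\<kappa> + 1 / \<kappa> = 2 * (1 - \<i> * of_real y) / of_real x"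
  shows "Im \<kappa> / Re \<kappa> \<le> norm (Complex x y)"
proof -
  define a b n where "a = Re \<kappa>" and "b = Im \<kappa>" and "n = a\<^sup>2 + b\<^sup>2"
  have a: "0 < a" using assms by (simp add: a_def)
  have n: "0 < n" using a by (simp add: n_def add_pos_nonneg)
  have inv: "1 / \<kappa> = Complex (a / n) (- b / n)"
    by (simp add: complex_eq_iff a_def b_def n_def Re_divide Im_divide)
  have re: "a + a / n = 2 / x"
    using arg_cong[OF eq, of Re] \<open>0 < x\<close> unfolding inv by (simp add: a_def)
  have im: "b - b / n = - 2 * y / x"
    using arg_cong[OF eq, of Im] \<open>0 < x\<close> unfolding inv by (simp add: b_def)
  define p where "p = 1 + 1 / n"
  define q where "q = 1 - 1 / n"
  have p0: "0 < p" using n by (simp add: p_def add_pos_pos)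
  have re': "a * p * x = 2" using re \<open>0 < x\<close> by (simp add: p_def field_simps)
  have im': "b * q * x = - 2 * y" using im \<open>0 < x\<close> by (simp add: q_def field_simps)
  have ay: "a * p * y = - b * q"
  proof -
    have "2 * (a * p * y) = - (a * p * x) * (b * q)" using im' by (simp add: algebra_simps)
    then show ?thesis using re' by simp
  qed
  have "b\<^sup>2 \<le> n" by (simp add: n_def)
  then have "b\<^sup>2 / n \<le> 1" using n by simp
  moreover have "b\<^sup>2 * p\<^sup>2 = b\<^sup>2 * q\<^sup>2 + 4 * (b\<^sup>2 / n)"
    by (simp add: p_def q_def power2_eq_square algebra_simps)
  ultimately have "(b * p)\<^sup>2 \<le> (- b * q)\<^sup>2 + 2\<^sup>2" by (simp add: power_mult_distrib)
  also have "\<dots> = (a * p)\<^sup>2 * (x\<^sup>2 + y\<^sup>2)"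
    unfolding ay[symmetric] re'[symmetric] by (simp add: power2_eq_square algebra_simps)
  also have "\<dots> = (a * norm (Complex x y))\<^sup>2 * p\<^sup>2" by (simp add: cmod_power2 power_mult_distrib)
  finally have "b\<^sup>2 * p\<^sup>2 \<le> (a * norm (Complex x y))\<^sup>2 * p\<^sup>2" by (simp add: power_mult_distrib)
  then have "b\<^sup>2 \<le> (a * norm (Complex x y))\<^sup>2" using p0 by simp
  then have "b \<le> a * norm (Complex x y)"
    by (rule power2_le_imp_le) (use a in \<open>simp del: complex_norm\<close>)
  then show ?thesis using a by (simp add: a_def b_def divide_le_eq mult.commute)
qed

text \<open>Makes Arg \<kappa> tend to pi / 2 at the imaginary axis at an explicit rate, with
  \<delta> = Re w / Re (orbit t). The bound is independent of Im w, so \<kappa> need not extend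
  continuously to the axis. The inequality 4 n <= (n + 1)^2 removes the unknown modulus of
  \<kappa>.\<close>

lemma Joukowski_angle_le:
  fixes \<kappa> :: complex
  assumes re: "0 < Re \<kappa>" and im: "0 < Im \<kappa>" and d: "Re (\<kappa> + 1 / \<kappa>) = 2 * \<delta>" "\<delta> \<le> 1 / 2"
  shows "pi / 2 - arctan (Im \<kappa> / Re \<kappa>) \<le> 2 * \<delta>"
proof -
  define a b n where "a = Re \<kappa>" and "b = Im \<kappa>" and "n = a\<^sup>2 + b\<^sup>2"
  have a: "0 < a" "0 < b" using assms by (simp_all add: a_def b_def)
  have n: "0 < n" using a by (simp add: n_def add_pos_nonneg)
  have "Re (1 / \<kappa>) = a / n" by (simp add: a_def b_def n_def Re_divide)
  then have "a + a / n = 2 * \<delta>" using d by (simp add: a_def)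
  then have eq: "a * (n + 1) = 2 * \<delta> * n" using n by (simp add: field_simps)
  have d0: "0 < \<delta>" using eq a n by (metis add_pos_pos mult_pos_pos zero_less_mult_pos2 zero_less_numeral zero_less_one mult.commute mult.left_commute)
  have "4 * n \<le> (n + 1)\<^sup>2" using zero_le_power2[of "n - 1"] by (simp add: power2_eq_square algebra_simps)
  then have "a\<^sup>2 * (4 * n) \<le> (a * (n + 1))\<^sup>2" by (simp add: power_mult_distrib mult_left_mono)
  also have "\<dots> = 4 * \<delta>\<^sup>2 * n\<^sup>2" unfolding eq by (simp add: power_mult_distrib)
  finally have "a\<^sup>2 \<le> \<delta>\<^sup>2 * n" using n by (simp add: power2_eq_square)
  also have "\<dots> \<le> \<delta>\<^sup>2 * b\<^sup>2 + (1/4) * a\<^sup>2"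
  proof -
    have "\<delta>\<^sup>2 \<le> (1/2)\<^sup>2" using d0 d by (intro power_mono) auto
    then have "\<delta>\<^sup>2 * a\<^sup>2 \<le> (1/4) * a\<^sup>2" by (intro mult_right_mono) (auto simp: power2_eq_square)
    then show ?thesis by (simp add: n_def algebra_simps)
  qed
  finally have "a\<^sup>2 \<le> \<delta>\<^sup>2 * b\<^sup>2 + (1/4) * a\<^sup>2" .
  moreover have "0 \<le> \<delta>\<^sup>2 * b\<^sup>2" by simp
  moreover have "(2 * \<delta> * b)\<^sup>2 = 4 * (\<delta>\<^sup>2 * b\<^sup>2)" by (simp add: power_mult_distrib)
  ultimately have "a\<^sup>2 \<le> (2 * \<delta> * b)\<^sup>2" by linarith
  then have "a \<le> 2 * \<delta> * b" by (rule power2_le_imp_le) (use a d0 in simp)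
  then have ab: "a / b \<le> 2 * \<delta>" using a by (simp add: divide_le_eq)
  have "pi / 2 - arctan (b / a) = arctan (a / b)"
    using arctan_inverse[of "b / a"] a by simp
  also have "\<dots> \<le> a / b" using a by (intro arctan_le_self) auto
  finally show ?thesis using ab by (simp add: a_def b_def)
qed

context half_plane_Koenigs
begin

text \<open>The region \<open>V\<close> misses the tail, so \<kappa> is defined on it. There 2 u -
  pi/2 + b is pi times the difference between the harmonic measure of the half circle, pulled back
  by g, and the lower bound for the tail. It is nonnegative in the limit at the boundary of
  \<open>V\<close>: because u = pi/2 where |g| = R, and because b tends to pi/2 at the imaginary
  axis. Its value at 1 gives the claim.\<close>

lemma orbit_comparison:
  assumes t: "0 < t" and g: "g holomorphic_on right_half_plane"
    and g_pos: "\<And>w. 0 < Re w \<Longrightarrow> 0 < Re (g w)" and g_1: "g 1 = 1"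
    and R: "1 < R" and far: "\<And>s. t \<le> s \<Longrightarrow> R \<le> norm (g (orbit s))"
  shows "pi / 2 - arctan (norm (orbit t)) \<le> 4 * arctan (1 / R)"
proof -
  define x where "x = Re (orbit t)"
  define y where "y = Im (orbit t)"
  have x1: "1 \<le> x" using Re_orbit_ge_1[of t] t by (simp add: x_def)
  obtain \<kappa> where \<kappa>: "\<kappa> holomorphic_on slit_domain t"
    and \<kappa>_pos: "\<And>w. w \<in> slit_domain t \<Longrightarrow> 0 < Re (\<kappa> w)"
    and \<kappa>_eq: "\<And>w. w \<in> slit_domain t \<Longrightarrow> \<kappa> w + 1 / \<kappa> w = 2 * (w - \<i> * of_real y) / of_real x"
    and \<kappa>_im: "\<And>w. 0 < Re w \<Longrightarrow> Re w < x \<Longrightarrow> 0 < Im (\<kappa> w)"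
    using slit_map[of t] t unfolding x_def y_def by auto
  define V where "V = {w. 0 < Re w \<and> norm (g w) < R}"
  have gcont: "continuous_on right_half_plane g" using g by (rule holomorphic_on_imp_continuous_on)
  have V_open: "open V"
  proof -
    have "V = right_half_plane \<inter> (\<lambda>w. norm (g w)) -` {..<R}" by (auto simp: V_def)
    then show ?thesis
      using continuous_open_preimage[OF continuous_on_norm[OF gcont] open_right_half_plane, of "{..<R}"] by simp
  qed
  have V_sub: "V \<subseteq> slit_domain t"
  proof
    fix w assume w: "w \<in> V"
    have "k w \<noteq> of_real s" if "t \<le> s" for s
      using far[OF that] orbit_eqI[of w s] w by (auto simp: V_def)
    then show "w \<in> slit_domain t" using w by (auto simp: slit_domain_def V_def)
  qed
  have V_rhp: "V \<subseteq> right_half_plane" by (auto simp: V_def)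
  define u where "u = (\<lambda>w. arctan (Re (g w) / (R - Im (g w))) + arctan (Re (g w) / (R + Im (g w))))"
  define b where "b = (\<lambda>w. arctan (Im (\<kappa> w) / Re (\<kappa> w)))"
  have im_g: "0 < R - Im (g w)" "0 < R + Im (g w)" if "0 < Re w" "norm (g w) \<le> R" for w
  proof -
    have "(Im (g w))\<^sup>2 < (norm (g w))\<^sup>2" using g_pos[OF that(1)] by (simp add: cmod_power2)
    then have "\<bar>Im (g w)\<bar> < norm (g w)" using power2_less_imp_less[of "\<bar>Im (g w)\<bar>" "norm (g w)"] by simp
    then show "0 < R - Im (g w)" "0 < R + Im (g w)" using that by auto
  qed
  have u_nonneg: "0 \<le> u w" if "0 < Re w" "norm (g w) \<le> R" for w
    unfolding u_def using im_g[OF that] g_pos[OF that(1)] by (auto intro!: add_nonneg_nonneg)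
  have b_ge: "- (pi / 2) < b w" for w unfolding b_def by (rule arctan_lbound)
  have main: "0 \<le> 2 * u 1 - pi / 2 + b 1 + \<epsilon> * ln 2" if \<epsilon>: "0 < \<epsilon>" for \<epsilon> :: real
  proof -
    \<comment> \<open>The logarithm tends to infinity and so removes the exceptional boundary point infinity.\<close>
    define F where "F = (\<lambda>w. - \<i> * (2 * (Ln (of_real R + \<i> * g w) - Ln (of_real R - \<i> * g w)) + Ln (\<kappa> w))
       - of_real (pi / 2) + of_real \<epsilon> * Ln (1 + w))"
    have Rg: "0 < Re (of_real R + \<i> * g w)" "0 < Re (of_real R - \<i> * g w)" if "w \<in> V" for w
      using im_g[of w] that by (auto simp: V_def)
    have F: "F holomorphic_on V"
      unfolding F_def
      by (intro holomorphic_intros holomorphic_on_subset[OF g V_rhp] holomorphic_on_subset[OF \<kappa> V_sub])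
         (use Rg \<kappa>_pos V_sub V_rhp in \<open>force simp: complex_nonpos_Reals_iff\<close>)+
    have ReF: "Re (F w) = 2 * u w - pi / 2 + b w + \<epsilon> * ln (norm (1 + w))" if "w \<in> V" for w
    proof -
      have "0 < Re (1 + w)" using V_rhp that by auto
      then have "1 + w \<noteq> 0" by (metis less_irrefl zero_complex.sel(1))
      then have "Re (Ln (1 + w)) = ln (norm (1 + w))" by simp
      moreover have "Im (Ln (\<kappa> w)) = b w"
        unfolding b_def using \<kappa>_pos V_sub that by (intro Im_Ln_arctan) auto
      \<comment> \<open>The points R + i g and R - i g have real parts R - Im g and R + Im g and
        imaginary parts Re g and - Re g.\<close>
      moreover have "Im (Ln (of_real R + \<i> * g w)) - Im (Ln (of_real R - \<i> * g w)) = u w"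
        unfolding Im_Ln_arctan[OF Rg(1)[OF that]] Im_Ln_arctan[OF Rg(2)[OF that]]
        by (simp add: u_def arctan_minus)
      ultimately show ?thesis unfolding F_def by (simp add: algebra_simps)
    qed
    have norm1: "1 \<le> norm (1 + w)" if "0 \<le> Re w" for w
      using complex_Re_le_cmod[of "1 + w"] that by simp
    have compact: "compact {w \<in> V. Re (F w) \<le> c}" (is "compact ?K") if c: "c < 0" for c
      unfolding compact_eq_bounded_closed
    proof
      show "bounded ?K"
        unfolding bounded_iff
      proof (intro exI ballI)
        fix w assume w: "w \<in> ?K"
        then have w0: "0 < Re w" "norm (g w) \<le> R" by (auto simp: V_def)
        have "\<epsilon> * ln (norm (1 + w)) \<le> pi"
          using ReF[of w] w c u_nonneg[OF w0] b_ge[of w] by simp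
        then have "ln (norm (1 + w)) \<le> pi / \<epsilon>" using \<epsilon> by (simp add: field_simps)
        then have "norm (1 + w) \<le> exp (pi / \<epsilon>)"
          using norm1[of w] w0 by (metis exp_le_cancel_iff exp_ln less_le_trans less_imp_le zero_less_one)
        then show "norm w \<le> exp (pi / \<epsilon>) + 1"
          using norm_triangle_ineq4[of "1 + w" 1] by simp
      qed
      \<comment> \<open>A limit of points of the sublevel set lies in \<open>V\<close>, on |g| = R,
        or on the imaginary axis; the last two are excluded by c < 0.\<close>
      show "closed ?K"
        unfolding closed_sequential_limits
      proof (intro allI impI, elim conjE)
        fix z l assume z: "\<forall>n. z n \<in> ?K" and lim: "z \<longlonglongrightarrow> l"
        have zV: "z n \<in> V" "Re (F (z n)) \<le> c" for n using z by auto
        have z0: "0 < Re (z n)" "norm (g (z n)) \<le> R" for n using zV[of n] by (auto simp: V_def)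
        have lower: "2 * u (z n) - pi / 2 + b (z n) \<le> c" for n
          using ReF[OF zV(1)[of n]] zV(2)[of n] norm1[of "z n"] z0(1)[of n] \<epsilon>
          by (smt (verit) ln_ge_zero mult_nonneg_nonneg)
        have Rel: "0 \<le> Re l"
          by (rule tendsto_lowerbound[OF tendsto_Re[OF lim]]) (use z0 in \<open>auto intro!: always_eventually less_imp_le\<close>)
        show "l \<in> ?K"
        proof (cases "0 < Re l")
          case True
          have gl: "(\<lambda>n. g (z n)) \<longlonglongrightarrow> g l"
            by (rule continuous_on_tendsto_compose[OF gcont lim]) (use True z0 in auto)
          have "norm (g l) \<le> R"
            by (rule tendsto_upperbound[OF tendsto_norm[OF gl]]) (use z0 in auto)
          \<comment> \<open>Since u tends to pi/2, the crude bound b > - pi/2 suffices. No limit of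
            \<kappa> is needed, which matters because l may lie on the tail.\<close>
          moreover have "norm (g l) \<noteq> R"
          proof
            assume eqR: "norm (g l) = R"
            have "(\<lambda>n. u (z n)) \<longlonglongrightarrow> u l"
              unfolding u_def by (intro tendsto_intros gl) (use im_g[OF True] eqR in auto)
            moreover have "u l = pi / 2"
              unfolding u_def
              by (rule arctan_sum_quarter) (use g_pos[OF True] eqR R in \<open>auto simp: cmod_power2[symmetric]\<close>)
            ultimately have "(\<lambda>n. 2 * u (z n) - pi) \<longlonglongrightarrow> 2 * (pi / 2) - pi"
              by (intro tendsto_intros) simp
            moreover have "2 * u (z n) - pi \<le> c" for n using lower[of n] b_ge[of "z n"] by simp
            ultimately have "2 * (pi / 2) - pi \<le> c" by (intro tendsto_upperbound[of _ _ sequentially c]) auto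
            then show False using c by simp
          qed
          ultimately have lV: "l \<in> V" using True by (simp add: V_def)
          have "(\<lambda>n. Re (F (z n))) \<longlonglongrightarrow> Re (F l)"
            by (intro tendsto_Re continuous_on_tendsto_compose[OF holomorphic_on_imp_continuous_on[OF F] lim lV])
               (use zV in auto)
          then have "Re (F l) \<le> c" by (rule tendsto_upperbound) (use zV in auto)
          then show ?thesis using lV by simp
        next
          \<comment> \<open>Only u \<ge> 0 is used here, so g need not have boundary values on the
            imaginary axis.\<close>
          case False
          then have Re0: "Re l = 0" using Rel by simp
          have "(\<lambda>n. 2 * (Re (z n) / x)) \<longlonglongrightarrow> 2 * (Re l / x)"
            by (intro tendsto_intros lim) (use x1 in simp)
          then have lim0: "(\<lambda>n. 2 * (Re (z n) / x)) \<longlonglongrightarrow> 0" by (simp add: Re0)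
          have "\<forall>\<^sub>F n in sequentially. Re (z n) < x / 2"
            using tendsto_Re[OF lim] Re0 x1 by (intro order_tendstoD) auto
          then have "\<forall>\<^sub>F n in sequentially. - c \<le> 2 * (Re (z n) / x)"
          proof eventually_elim
            case (elim n)
            have "pi / 2 - b (z n) \<le> 2 * (Re (z n) / x)"
              unfolding b_def
            proof (rule Joukowski_angle_le)
              have zs: "z n \<in> slit_domain t" using zV V_sub by blast
              show "0 < Re (\<kappa> (z n))" by (rule \<kappa>_pos[OF zs])
              show "0 < Im (\<kappa> (z n))" using \<kappa>_im[OF z0(1)[of n]] elim x1 by simp
              show "Re (\<kappa> (z n) + 1 / \<kappa> (z n)) = 2 * (Re (z n) / x)" unfolding \<kappa>_eq[OF zs] by simp
              show "Re (z n) / x \<le> 1 / 2" using elim x1 by (simp add: field_simps)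
            qed
            then show ?case using lower[of n] u_nonneg[OF z0[of n]] by simp
          qed
          then have "- c \<le> 0" by (intro tendsto_lowerbound[OF lim0]) auto
          then show ?thesis using c by simp
        qed
      qed
    qed
    have "1 \<in> V" using g_1 R by (simp add: V_def)
    then have "0 \<le> Re (F 1)" by (intro Re_nonneg_if_sublevel_compact[OF V_open F compact])
    then show ?thesis using ReF[OF \<open>1 \<in> V\<close>] by simp
  qed
  have ineq: "0 \<le> 2 * u 1 - pi / 2 + b 1"
  proof (rule field_le_epsilon)
    \<comment> \<open>At w = 1 the logarithm in \<open>F\<close> equals ln 2, hence the choice of
      \<epsilon> below.\<close>
    fix e :: real assume e: "0 < e"
    then show "0 \<le> 2 * u 1 - pi / 2 + b 1 + e" using main[of "e / ln 2"] by simp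
  qed
  have u1: "u 1 = 2 * arctan (1 / R)" by (simp add: u_def g_1)
  have s1: "1 \<in> slit_domain t" using V_sub g_1 R by (auto simp: V_def)
  have "Im (\<kappa> 1) / Re (\<kappa> 1) \<le> norm (Complex x y)"
    by (rule Joukowski_slope_le) (use \<kappa>_pos[OF s1] \<kappa>_eq[OF s1] x1 in auto)
  then have "b 1 \<le> arctan (norm (orbit t))"
    unfolding b_def x_def y_def by (simp add: arctan_le_iff)
  then show ?thesis using ineq u1 by simp
qed
end

section \<open>From the disk to the half-plane\<close>

lemma one_minus_mult_cnj_nz:
  assumes "z \<in> unit_disk" "norm u \<le> 1"
  shows "1 - z * cnj u \<noteq> 0"
proof -
  have "norm (z * cnj u) \<le> norm z * 1" unfolding norm_mult by (rule mult_left_mono) (use assms in auto)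
  then have "norm (z * cnj u) < 1" using assms by simp
  then show ?thesis by force
qed

lemma norm_one_minus_mult_cnj:
  assumes "norm \<tau> = 1"
  shows "norm (1 - z * cnj \<tau>) = norm (\<tau> - z)"
proof -
  have "\<tau> * cnj \<tau> = 1" using assms by (simp add: complex_norm_square[symmetric])
  then have "\<tau> * (1 - z * cnj \<tau>) = \<tau> - z" by (simp add: algebra_simps)
  then show ?thesis using assms by (metis mult_1 norm_mult)
qed

lemma one_minus_pseudo_hyp_sq:
  assumes "z \<in> unit_disk" "u \<in> unit_disk"
  shows "1 - (norm (pseudo_hyp z u))\<^sup>2 = (1 - (norm z)\<^sup>2) * (1 - (norm u)\<^sup>2) / (norm (1 - z * cnj u))\<^sup>2"
proof -
  have nz: "norm (1 - z * cnj u) \<noteq> 0" using one_minus_mult_cnj_nz[of z u] assms by simp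
  have "(norm (1 - z * cnj u))\<^sup>2 - (norm (z - u))\<^sup>2 = (1 - (norm z)\<^sup>2) * (1 - (norm u)\<^sup>2)"
    unfolding cmod_power2 by (simp add: power2_eq_square algebra_simps)
  then show ?thesis using nz by (simp add: pseudo_hyp_def norm_divide power_divide field_simps)
qed

lemma pseudo_hyp_less_1:
  assumes "z \<in> unit_disk" "u \<in> unit_disk"
  shows "norm (pseudo_hyp z u) < 1"
  using Moebius_function_norm_lt_1[of u z 0] assms by (simp add: Moebius_function_simple pseudo_hyp_def mult.commute)

lemma Schwarz_Pick:
  assumes f: "f holomorphic_on unit_disk" "f ` unit_disk \<subseteq> unit_disk"
    and z: "z \<in> unit_disk" and w: "w \<in> unit_disk"
  shows "norm (pseudo_hyp (f z) (f w)) \<le> norm (pseudo_hyp z w)"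
proof -
  have fd: "norm (f v) < 1" if "norm v < 1" for v using f(2) that by force
  define F where "F = Moebius_function 0 (f w) \<circ> f \<circ> Moebius_function 0 (- w)"
  define \<xi> where "\<xi> = Moebius_function 0 w z"
  have m: "norm (Moebius_function 0 (- w) v) < 1" if "norm v < 1" for v
    using Moebius_function_norm_lt_1[of "- w" v 0] that w by simp
  have "norm (F \<xi>) \<le> norm \<xi>"
  proof (rule Schwarz_Lemma(1))
    show "F holomorphic_on ball 0 1"
      unfolding F_def
      by (intro holomorphic_on_compose holomorphic_on_subset[OF Moebius_function_holomorphic]
          holomorphic_on_subset[OF f(1)]) (use m fd w in \<open>auto simp: o_def\<close>)
    show "F 0 = 0" by (simp add: F_def Moebius_function_of_zero Moebius_function_eq_zero)
    show "norm (F v) < 1" if "norm v < 1" for v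
      using Moebius_function_norm_lt_1[of "f w" _ 0] fd m that w by (simp add: F_def)
    show "norm \<xi> < 1" using Moebius_function_norm_lt_1[of w z 0] z w by (simp add: \<xi>_def)
  qed
  moreover have "F \<xi> = Moebius_function 0 (f w) (f z)"
    using Moebius_function_compose[of "- w" w z] z w by (simp add: F_def \<xi>_def)
  ultimately show ?thesis
    by (simp add: \<xi>_def Moebius_function_simple pseudo_hyp_def mult.commute)
qed

text \<open>Schwarz-Pick at \<open>v n\<close> and \<open>z\<close> gives the claim in the limit along those \<open>n\<close> for which
  \<open>|v (n + 1)| \<ge> |v n|\<close>; there are infinitely many of them, as \<open>|v n|\<close> tends to 1.\<close>

lemma Julia_orbit:
  assumes f: "f holomorphic_on unit_disk" "f ` unit_disk \<subseteq> unit_disk"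
    and v: "\<And>n::nat. v n \<in> unit_disk" "\<And>n. v (Suc n) = f (v n)" "v \<longlonglongrightarrow> \<tau>"
    and \<tau>: "norm \<tau> = 1" and z: "z \<in> unit_disk"
  shows "(norm (\<tau> - f z))\<^sup>2 / (1 - (norm (f z))\<^sup>2) \<le> (norm (\<tau> - z))\<^sup>2 / (1 - (norm z)\<^sup>2)"
proof (rule ccontr)
  define L where "L = (\<lambda>n. (norm (1 - f z * cnj (v (Suc n))))\<^sup>2 / (1 - (norm (f z))\<^sup>2))"
  define Rr where "Rr = (\<lambda>n. (norm (1 - z * cnj (v n)))\<^sup>2 / (1 - (norm z)\<^sup>2))"
  have fz: "f z \<in> unit_disk" using f z by blast
  have pos: "0 < 1 - (norm u)\<^sup>2" if "u \<in> unit_disk" for u :: complex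
    using that by (simp add: power_less_one_iff)
  have L: "L \<longlonglongrightarrow> (norm (1 - f z * cnj \<tau>))\<^sup>2 / (1 - (norm (f z))\<^sup>2)"
    unfolding L_def using LIMSEQ_Suc[OF v(3)] pos[OF fz] by (intro tendsto_intros) auto
  have Rr: "Rr \<longlonglongrightarrow> (norm (1 - z * cnj \<tau>))\<^sup>2 / (1 - (norm z)\<^sup>2)"
    unfolding Rr_def using v(3) pos[OF z] by (intro tendsto_intros) auto
  assume "\<not> (norm (\<tau> - f z))\<^sup>2 / (1 - (norm (f z))\<^sup>2) \<le> (norm (\<tau> - z))\<^sup>2 / (1 - (norm z)\<^sup>2)"
  then have "\<forall>\<^sub>F n in sequentially. 0 < L n - Rr n"
    using tendsto_diff[OF L Rr] unfolding norm_one_minus_mult_cnj[OF \<tau>] by (intro order_tendstoD) auto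
  then obtain N where N: "\<And>n. N \<le> n \<Longrightarrow> Rr n < L n" by (auto simp: eventually_sequentially)
  \<comment> \<open>Past N an increase of the norm would contradict Schwarz-Pick, so the norms never
    exceed \<open>norm (v N)\<close> < 1 again, although they tend to 1.\<close>
  have dec: "norm (v (Suc n)) \<le> norm (v n)" if "N \<le> n" for n
  proof (rule ccontr)
    assume "\<not> norm (v (Suc n)) \<le> norm (v n)"
    then have "(norm (v n))\<^sup>2 \<le> (norm (v (Suc n)))\<^sup>2" by (intro power_mono) auto
    then have le: "1 - (norm (v (Suc n)))\<^sup>2 \<le> 1 - (norm (v n))\<^sup>2" by simp
    have "norm (pseudo_hyp (f z) (v (Suc n))) \<le> norm (pseudo_hyp z (v n))"
      unfolding v(2) by (rule Schwarz_Pick[OF f z v(1)])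
    then have "1 - (norm (pseudo_hyp z (v n)))\<^sup>2 \<le> 1 - (norm (pseudo_hyp (f z) (v (Suc n))))\<^sup>2"
      by (simp add: power_mono)
    then have "(1 - (norm (v n))\<^sup>2) / Rr n \<le> (1 - (norm (v (Suc n)))\<^sup>2) / L n"
      unfolding one_minus_pseudo_hyp_sq[OF z v(1)] one_minus_pseudo_hyp_sq[OF fz v(1)]
      by (simp add: Rr_def L_def mult.commute)
    also have L0: "0 < L n" unfolding L_def
      using one_minus_mult_cnj_nz[OF fz, of "v (Suc n)"] v(1)[of "Suc n"] pos[OF fz] by (intro divide_pos_pos) auto
    have "(1 - (norm (v (Suc n)))\<^sup>2) / L n \<le> (1 - (norm (v n))\<^sup>2) / L n"
      using le L0 by (intro divide_right_mono) auto
    finally have *: "(1 - (norm (v n))\<^sup>2) / Rr n \<le> (1 - (norm (v n))\<^sup>2) / L n" .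
    have R0: "0 < Rr n" unfolding Rr_def
      using one_minus_mult_cnj_nz[OF z, of "v n"] v(1)[of n] pos[OF z] by (intro divide_pos_pos) auto
    have "(1 - (norm (v n))\<^sup>2) / L n < (1 - (norm (v n))\<^sup>2) / Rr n"
      using N[OF that] R0 L0 pos[OF v(1)[of n]] by (intro divide_strict_left_mono) auto
    then show False using * by simp
  qed
  have "norm (v n) \<le> norm (v N)" if "N \<le> n" for n
    using that by (induction n rule: dec_induct) (use dec order_trans in blast)+
  then have "\<forall>\<^sub>F n in sequentially. norm (v n) \<le> norm (v N)" by (auto simp: eventually_sequentially)
  then have "norm \<tau> \<le> norm (v N)" by (intro tendsto_upperbound[OF tendsto_norm[OF v(3)]]) auto
  then show False using \<tau> v(1)[of N] by simp
qed

section \<open>Transfer of the semigroup to the half-plane\<close>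

lemma Cayley_inverse:
  fixes \<tau> z w :: complex
  assumes "\<tau> \<noteq> 0"
  shows "0 < Re w \<Longrightarrow> (\<tau> + \<tau> * ((w - 1) / (w + 1))) / (\<tau> - \<tau> * ((w - 1) / (w + 1))) = w"
    and "z \<noteq> \<tau> \<Longrightarrow> \<tau> * (((\<tau> + z) / (\<tau> - z) - 1) / ((\<tau> + z) / (\<tau> - z) + 1)) = z"
proof -
  assume "0 < Re w"
  then have w: "w + 1 \<noteq> 0" by (auto simp: complex_eq_iff)
  have "\<tau> + \<tau> * ((w - 1) / (w + 1)) = \<tau> * 2 * w / (w + 1)" "\<tau> - \<tau> * ((w - 1) / (w + 1)) = \<tau> * 2 / (w + 1)"
    using w by (simp_all add: field_simps)
  then show "(\<tau> + \<tau> * ((w - 1) / (w + 1))) / (\<tau> - \<tau> * ((w - 1) / (w + 1))) = w"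
    using w assms by simp
next
  assume z: "z \<noteq> \<tau>"
  then have d: "\<tau> - z \<noteq> 0" by simp
  have "(\<tau> + z) / (\<tau> - z) - 1 = 2 * z / (\<tau> - z)" "(\<tau> + z) / (\<tau> - z) + 1 = 2 * \<tau> / (\<tau> - z)"
    using d by (simp_all add: field_simps)
  then show "\<tau> * (((\<tau> + z) / (\<tau> - z) - 1) / ((\<tau> + z) / (\<tau> - z) + 1)) = z" using d assms by simp
qed

lemma Re_Cayley:
  assumes "norm \<tau> = 1"
  shows "Re ((\<tau> + z) / (\<tau> - z)) = (1 - (norm z)\<^sup>2) / (norm (\<tau> - z))\<^sup>2"
proof -
  have "(Re \<tau>)\<^sup>2 + (Im \<tau>)\<^sup>2 = 1" using assms by (simp add: cmod_power2[symmetric])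
  then show ?thesis
    unfolding Re_divide cmod_power2 by (simp add: power2_eq_square algebra_simps)
qed

text \<open>For fixed t > 0 the iterates of \<open>\<phi> t\<close> from 0 are the points
  \<open>\<phi> (n * t) 0\<close>, which tend to \<tau>, so \<open>Julia_orbit\<close> applies. Its
  quotient is the reciprocal of the real part of the Cayley image, whence the inequality required by
  \<open>shift\<close>.\<close>

lemma Koenigs_half_plane:
  assumes \<phi>: "holomorphic_semigroup \<phi>" and DW: "is_Denjoy_Wolff_point \<phi> \<tau>"
    and h: "is_Koenigs_function \<phi> h"
  defines "k \<equiv> \<lambda>w. h (\<tau> * ((w - 1) / (w + 1)))"
  shows "half_plane_Koenigs k"
    and "0 \<le> t \<Longrightarrow> half_plane_Koenigs.orbit k t = (\<tau> + \<phi> t 0) / (\<tau> - \<phi> t 0)"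
    and "k ` right_half_plane = h ` unit_disk"
proof -
  define Z where "Z = (\<lambda>w. \<tau> * ((w - 1) / (w + 1)))"
  define C where "C = (\<lambda>z. (\<tau> + z) / (\<tau> - z))"
  have \<tau>: "norm \<tau> = 1" using DW by (simp add: is_Denjoy_Wolff_point_def)
  then have \<tau>0: "\<tau> \<noteq> 0" by auto
  have lim: "((\<lambda>t. \<phi> t z) \<longlongrightarrow> \<tau>) at_top" if "z \<in> unit_disk" for z
    using DW that by (simp add: is_Denjoy_Wolff_point_def)
  have hol: "h holomorphic_on unit_disk" and inj: "inj_on h unit_disk" and h0: "h 0 = 0"
    using h by (auto simp: is_Koenigs_function_def)
  have \<phi>_maps: "\<phi> t holomorphic_on unit_disk" "\<phi> t ` unit_disk \<subseteq> unit_disk" if "0 \<le> t" for t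
    using \<phi> that by (auto simp: holomorphic_semigroup_def)
  have \<phi>_in: "\<phi> t z \<in> unit_disk" if "0 \<le> t" "z \<in> unit_disk" for t z using \<phi>_maps[OF that(1)] that by blast
  have h\<phi>: "h (\<phi> t z) = h z + of_real t" if "0 \<le> t" "z \<in> unit_disk" for t z
    using h that unfolding is_Koenigs_function_def by (metis f_inv_into_f)
  have Z1: "Z w \<in> unit_disk" if "0 < Re w" for w
    using norm_Cayley_less_1[OF that] \<tau> by (simp add: Z_def norm_mult del: times_divide_eq_right)
  have ne: "z \<noteq> \<tau>" if "z \<in> unit_disk" for z using that \<tau> by auto
  have ZC: "Z (C z) = z" if "z \<in> unit_disk" for z
    unfolding Z_def C_def by (rule Cayley_inverse(2)[OF \<tau>0 ne[OF that]])
  have CZ: "C (Z w) = w" if "0 < Re w" for w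
    unfolding Z_def C_def by (rule Cayley_inverse(1)[OF \<tau>0 that])
  have ReC: "Re (C z) = (1 - (norm z)\<^sup>2) / (norm (\<tau> - z))\<^sup>2" for z
    unfolding C_def by (rule Re_Cayley[OF \<tau>])
  have sq: "0 < 1 - (norm z)\<^sup>2" "0 < (norm (\<tau> - z))\<^sup>2" if "z \<in> unit_disk" for z
    using that ne[OF that] by (auto simp: power_less_one_iff)
  have C0: "0 < Re (C z)" if "z \<in> unit_disk" for z
    unfolding ReC using sq[OF that] by simp
  have k: "k w = h (Z w)" for w by (simp add: k_def Z_def)
  have kZ: "k = h \<circ> Z" by (auto simp: k)
  have Julia: "Re (C z) \<le> Re (C (\<phi> t z))" if t: "0 \<le> t" and z: "z \<in> unit_disk" for t z
  proof (cases "t = 0")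
    case True
    then show ?thesis using \<phi> z by (simp add: holomorphic_semigroup_def)
  next
    case False
    define v where "v = (\<lambda>n::nat. \<phi> (of_nat n * t) 0)"
    have t0: "0 < t" using False t by simp
    have v1: "v n \<in> unit_disk" for n unfolding v_def using \<phi>_in t by simp
    have v2: "v (Suc n) = \<phi> t (v n)" for n
    proof -
      have "\<phi> (t + of_nat n * t) 0 = \<phi> t (\<phi> (of_nat n * t) 0)"
        using \<phi> t unfolding holomorphic_semigroup_def by simp
      then show ?thesis by (simp add: v_def algebra_simps)
    qed
    have "filterlim (\<lambda>n::nat. of_nat n * t) at_top sequentially"
      by (rule filterlim_at_top_mult_tendsto_pos[OF tendsto_const t0 filterlim_real_sequentially])
    then have v3: "v \<longlonglongrightarrow> \<tau>"
      using filterlim_compose[OF lim[of 0]] by (fastforce simp: v_def)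
    have J: "(norm (\<tau> - \<phi> t z))\<^sup>2 / (1 - (norm (\<phi> t z))\<^sup>2) \<le> (norm (\<tau> - z))\<^sup>2 / (1 - (norm z)\<^sup>2)"
      by (rule Julia_orbit[OF \<phi>_maps[OF t] v1 v2 v3 \<tau> z])
    have "inverse ((norm (\<tau> - z))\<^sup>2 / (1 - (norm z)\<^sup>2)) \<le> inverse ((norm (\<tau> - \<phi> t z))\<^sup>2 / (1 - (norm (\<phi> t z))\<^sup>2))"
      using J sq[OF \<phi>_in[OF t z]] by (intro le_imp_inverse_le) auto
    then show ?thesis unfolding ReC by (simp add: inverse_eq_divide)
  qed
  show hpk: "half_plane_Koenigs k"
  proof
    have "Z holomorphic_on right_half_plane"
      unfolding Z_def by (intro holomorphic_intros) (auto simp: complex_eq_iff)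
    moreover have "Z ` right_half_plane \<subseteq> unit_disk" using Z1 by blast
    ultimately show "k holomorphic_on right_half_plane"
      using holomorphic_on_compose_gen[OF _ hol, of Z right_half_plane] by (simp add: kZ)
    show "inj_on k right_half_plane"
      using inj Z1 CZ unfolding inj_on_def k by (metis mem_Collect_eq)
    show "k 1 = 0" by (simp add: k_def h0)
    fix w and t :: real assume w: "0 < Re w" and t: "0 \<le> t"
    show "\<exists>v. Re w \<le> Re v \<and> k v = k w + of_real t"
    proof (intro exI conjI)
      show "Re w \<le> Re (C (\<phi> t (Z w)))" using Julia[OF t Z1[OF w]] CZ[OF w] by simp
      show "k (C (\<phi> t (Z w))) = k w + of_real t"
        unfolding k using ZC[OF \<phi>_in[OF t Z1[OF w]]] h\<phi>[OF t Z1[OF w]] by simp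
    qed
  qed
  show "half_plane_Koenigs.orbit k t = (\<tau> + \<phi> t 0) / (\<tau> - \<phi> t 0)" if t: "0 \<le> t"
  proof -
    have 0: "0 \<in> unit_disk" by simp
    have "C (\<phi> t 0) = half_plane_Koenigs.orbit k t"
    proof (rule half_plane_Koenigs.orbit_eqI[OF hpk])
      show "0 < Re (C (\<phi> t 0))" by (rule C0[OF \<phi>_in[OF t 0]])
      show "k (C (\<phi> t 0)) = of_real t" unfolding k using ZC[OF \<phi>_in[OF t 0]] h\<phi>[OF t 0] h0 by simp
    qed
    then show ?thesis by (simp add: C_def)
  qed
  show "k ` right_half_plane = h ` unit_disk"
  proof -
    have "Z ` right_half_plane = unit_disk"
    proof
      show "Z ` right_half_plane \<subseteq> unit_disk" using Z1 by blast
      show "unit_disk \<subseteq> Z ` right_half_plane"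
      proof
        fix z assume z: "z \<in> unit_disk"
        have "C z \<in> right_half_plane" using C0[OF z] by simp
        then show "z \<in> Z ` right_half_plane" using ZC[OF z] by (metis imageI)
      qed
    qed
    then show ?thesis unfolding kZ by (metis image_comp)
  qed
qed

section \<open>The projection onto the diameter\<close>

lemma hyp_dist_le_iff:
  assumes z: "z \<in> unit_disk" "u \<in> unit_disk" "u' \<in> unit_disk"
  shows "hyp_dist z u \<le> hyp_dist z u' \<longleftrightarrow> 1 - (norm (pseudo_hyp z u'))\<^sup>2 \<le> 1 - (norm (pseudo_hyp z u))\<^sup>2"
proof -
  define p where "p = norm (pseudo_hyp z u)"
  define q where "q = norm (pseudo_hyp z u')"
  have p: "0 \<le> p" "p < 1" and q: "0 \<le> q" "q < 1"
    using pseudo_hyp_less_1 z by (auto simp: p_def q_def)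
  have "hyp_dist z u \<le> hyp_dist z u' \<longleftrightarrow> ln ((1 + p) / (1 - p)) \<le> ln ((1 + q) / (1 - q))"
    by (simp add: hyp_dist_def p_def q_def)
  also have "\<dots> \<longleftrightarrow> (1 + p) / (1 - p) \<le> (1 + q) / (1 - q)"
    using p q by (intro ln_le_cancel_iff divide_pos_pos) auto
  also have "\<dots> \<longleftrightarrow> (1 + p) * (1 - q) \<le> (1 + q) * (1 - p)"
    using p q by (simp add: divide_le_eq le_divide_eq mult.commute)
  also have "\<dots> \<longleftrightarrow> p \<le> q" by (auto simp: algebra_simps)
  also have "\<dots> \<longleftrightarrow> p\<^sup>2 \<le> q\<^sup>2" using p q by simp
  finally show ?thesis by (simp add: p_def q_def)
qed

text \<open>The second point is the one on the diameter whose Cayley image is the positive number v.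
  In the denominator v occurs only in (v - m)^2 / v, so the nearest point has v = m: projecting onto
  the diameter means taking the modulus in the half-plane.\<close>

lemma pseudo_hyp_diameter:
  assumes \<tau>: "norm \<tau> = 1" and z: "z \<in> unit_disk" and v: "0 < v"
  defines "m \<equiv> norm ((\<tau> + z) / (\<tau> - z))"
  shows "1 - (norm (pseudo_hyp z (of_real ((v - 1) / (v + 1)) * \<tau>)))\<^sup>2 =
    4 * (1 - (norm z)\<^sup>2) / ((norm (\<tau> - z))\<^sup>2 * ((v - m)\<^sup>2 / v + 2 * m) + 2 * (1 - (norm z)\<^sup>2))"
proof -
  define r where "r = (v - 1) / (v + 1)"
  define p where "p = Re (z * cnj \<tau>)"
  define n where "n = (norm z)\<^sup>2"
  define E where "E = (norm (\<tau> - z))\<^sup>2 * ((v - m)\<^sup>2 / v + 2 * m) + 2 * (1 - n)"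
  have r: "-1 < r" "r < 1" using v by (auto simp: r_def field_simps)
  have rd: "of_real r * \<tau> \<in> unit_disk" using r \<tau> by (simp add: norm_mult abs_less_iff)
  have tt: "(Re \<tau>)\<^sup>2 + (Im \<tau>)\<^sup>2 = 1" using \<tau> by (simp add: cmod_power2[symmetric])
  have A: "(norm (\<tau> - z))\<^sup>2 = 1 - 2 * p + n" and B: "(norm (\<tau> + z))\<^sup>2 = 1 + 2 * p + n"
    using tt unfolding p_def n_def cmod_power2 by (simp_all add: power2_eq_square algebra_simps)
  have D: "(norm (1 - z * cnj (of_real r * \<tau>)))\<^sup>2 = 1 - 2 * r * p + r\<^sup>2 * n"
  proof -
    have "norm (1 - z * cnj (of_real r * \<tau>)) = norm (\<tau> - of_real r * z)"
      using norm_one_minus_mult_cnj[OF \<tau>, of "of_real r * z"] by (simp add: mult_ac)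
    moreover have "(norm (\<tau> - of_real r * z))\<^sup>2 = ((Re \<tau>)\<^sup>2 + (Im \<tau>)\<^sup>2) - 2 * r * p + r\<^sup>2 * n"
      unfolding p_def n_def cmod_power2 by (simp add: power2_eq_square algebra_simps)
    ultimately show ?thesis using tt by simp
  qed
  have ne: "\<tau> \<noteq> z" using \<tau> z by auto
  have m2: "(norm (\<tau> - z))\<^sup>2 * m\<^sup>2 = (norm (\<tau> + z))\<^sup>2"
    using ne by (simp add: m_def norm_divide power_divide)
  have "4 * v * (1 - 2 * r * p + r\<^sup>2 * n) = (1 - r\<^sup>2) * ((1 - 2 * p + n) * v\<^sup>2 + 2 * (1 - n) * v + (1 + 2 * p + n))"
  proof -
    have "v + 1 \<noteq> 0" using v by simp
    then have rv: "r * (v + 1) = v - 1" by (simp add: r_def)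
    have "(v + 1)\<^sup>2 * (1 - 2 * r * p + r\<^sup>2 * n) = (v + 1)\<^sup>2 - 2 * (r * (v + 1)) * (v + 1) * p + (r * (v + 1))\<^sup>2 * n"
      by (simp add: power2_eq_square algebra_simps)
    also have "\<dots> = (1 - 2 * p + n) * v\<^sup>2 + 2 * (1 - n) * v + (1 + 2 * p + n)"
      unfolding rv by (simp add: power2_eq_square algebra_simps)
    finally have 1: "(v + 1)\<^sup>2 * (1 - 2 * r * p + r\<^sup>2 * n) = (1 - 2 * p + n) * v\<^sup>2 + 2 * (1 - n) * v + (1 + 2 * p + n)" .
    have "(v + 1)\<^sup>2 * (1 - r\<^sup>2) = (v + 1)\<^sup>2 - (r * (v + 1))\<^sup>2" by (simp add: power2_eq_square algebra_simps)
    also have "\<dots> = 4 * v" unfolding rv by (simp add: power2_eq_square algebra_simps)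
    finally have 2: "(v + 1)\<^sup>2 * (1 - r\<^sup>2) = 4 * v" .
    show ?thesis unfolding 1[symmetric] 2[symmetric] by (simp add: mult_ac)
  qed
  also have "(1 - 2 * p + n) * v\<^sup>2 + 2 * (1 - n) * v + (1 + 2 * p + n) = v * E"
  proof -
    define Y where "Y = (norm (\<tau> - z))\<^sup>2 * ((v - m)\<^sup>2 / v + 2 * m)"
    have "v * Y = (norm (\<tau> - z))\<^sup>2 * ((v - m)\<^sup>2 + 2 * m * v)"
      using v by (simp add: Y_def field_simps)
    also have "\<dots> = (norm (\<tau> - z))\<^sup>2 * v\<^sup>2 + (norm (\<tau> - z))\<^sup>2 * m\<^sup>2" by (simp add: power2_eq_square algebra_simps)
    also have "\<dots> = (1 - 2 * p + n) * v\<^sup>2 + (1 + 2 * p + n)" by (simp only: m2) (simp only: A B)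
    finally have "v * Y + v * (2 * (1 - n)) = (1 - 2 * p + n) * v\<^sup>2 + 2 * (1 - n) * v + (1 + 2 * p + n)"
      by simp
    then show ?thesis unfolding E_def Y_def[symmetric] by (simp only: distrib_left)
  qed
  finally have "4 * v * (1 - 2 * r * p + r\<^sup>2 * n) = (1 - r\<^sup>2) * (v * E)" .
  then have "v * (4 * (1 - 2 * r * p + r\<^sup>2 * n)) = v * ((1 - r\<^sup>2) * E)" by (simp only: mult_ac)
  then have eq: "4 * (1 - 2 * r * p + r\<^sup>2 * n) = (1 - r\<^sup>2) * E" using v by (metis mult_cancel_left less_irrefl)
  have D0: "1 - 2 * r * p + r\<^sup>2 * n \<noteq> 0"
    unfolding D[symmetric] using one_minus_mult_cnj_nz[OF z, of "of_real r * \<tau>"] rd by simp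
  have E0: "E \<noteq> 0" using eq D0 by auto
  have nr: "(norm (of_real r * \<tau>))\<^sup>2 = r\<^sup>2" using \<tau> by (simp add: norm_mult)
  have "1 - (norm (pseudo_hyp z (of_real r * \<tau>)))\<^sup>2 = (1 - n) * (1 - r\<^sup>2) / (1 - 2 * r * p + r\<^sup>2 * n)"
    unfolding one_minus_pseudo_hyp_sq[OF z rd] D nr n_def ..
  also have "\<dots> = 4 * (1 - n) / E"
  proof -
    have "a * b / X = 4 * a / Y" if "4 * X = b * Y" "X \<noteq> 0" "Y \<noteq> 0" for a b X Y :: real
    proof -
      have "a * b * Y = 4 * a * X" using that(1) by (metis mult.assoc mult.left_commute)
      then show ?thesis using that by (simp add: frac_eq_eq)
    qed
    from this[OF eq D0 E0] show ?thesis .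
  qed
  finally show ?thesis by (simp only: r_def n_def E_def)
qed

text \<open>The minimum of \<open>E\<close> at m is strict, and this gives the uniqueness on which
  the definite description in \<open>hyp_proj\<close> depends.\<close>

lemma hyp_proj_eq:
  assumes \<tau>: "norm \<tau> = 1" and z: "z \<in> unit_disk"
  defines "m \<equiv> norm ((\<tau> + z) / (\<tau> - z))"
  assumes m: "0 < m"
  shows "hyp_proj \<tau> z = of_real ((m - 1) / (m + 1)) * \<tau>"
proof -
  define E where "E = (\<lambda>v. (norm (\<tau> - z))\<^sup>2 * ((v - m)\<^sup>2 / v + 2 * m) + 2 * (1 - (norm z)\<^sup>2))"
  define P where "P = (\<lambda>v::real. of_real ((v - 1) / (v + 1)) * \<tau>)"
  have ne: "\<tau> \<noteq> z" using \<tau> z by auto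
  have z2: "0 < 1 - (norm z)\<^sup>2" using z by (simp add: power_less_one_iff)
  have A: "0 < (norm (\<tau> - z))\<^sup>2" using ne by simp
  have E0: "0 < E v" if "0 < v" for v
    unfolding E_def using that m z2 A by (intro add_nonneg_pos mult_nonneg_nonneg) auto
  have Pd: "P v \<in> unit_disk" and Pdiam: "P v \<in> diameter_to \<tau>" if "0 < v" for v
  proof -
    have r: "-1 < (v - 1) / (v + 1)" "(v - 1) / (v + 1) < 1" using that by (auto simp: field_simps)
    have "norm (P v) = \<bar>(v - 1) / (v + 1)\<bar>"
      by (simp only: P_def norm_mult norm_of_real \<tau> mult_1_right)
    also have "\<dots> < 1" unfolding abs_less_iff using r by linarith
    finally show "P v \<in> unit_disk" by simp
    show "P v \<in> diameter_to \<tau>" unfolding diameter_to_def P_def using r by blast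
  qed
  have diam: "\<exists>v>0. u = P v" if u: "u \<in> diameter_to \<tau>" for u
  proof -
    obtain r where r: "u = of_real r * \<tau>" "-1 < r" "r < 1" using u by (auto simp: diameter_to_def)
    define v where "v = (1 + r) / (1 - r)"
    have "v - 1 = 2 * r / (1 - r)" "v + 1 = 2 / (1 - r)" using r by (simp_all add: v_def field_simps)
    then have "(v - 1) / (v + 1) = r" using r by simp
    moreover have "0 < v" using r by (simp add: v_def)
    ultimately show ?thesis unfolding P_def r(1) by metis
  qed
  have le_iff: "hyp_dist z (P v) \<le> hyp_dist z (P v') \<longleftrightarrow> E v \<le> E v'" if v: "0 < v" "0 < v'" for v v'
  proof -
    have "1 - (norm (pseudo_hyp z (P v)))\<^sup>2 = 4 * (1 - (norm z)\<^sup>2) / E v" if "0 < v" for v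
      using pseudo_hyp_diameter[OF \<tau> z that] by (simp add: P_def E_def m_def)
    then have "hyp_dist z (P v) \<le> hyp_dist z (P v') \<longleftrightarrow> 4 * (1 - (norm z)\<^sup>2) / E v' \<le> 4 * (1 - (norm z)\<^sup>2) / E v"
      using hyp_dist_le_iff[OF z Pd Pd] v by simp
    also have "\<dots> \<longleftrightarrow> E v \<le> E v'"
      using E0[OF v(1)] E0[OF v(2)] z2 by (simp add: divide_le_eq le_divide_eq mult_le_cancel_left_pos)
    finally show ?thesis .
  qed
  have Em: "E m \<le> E v" if "0 < v" for v
    unfolding E_def using that A by (simp add: mult_left_mono)
  have Eeq: "v = m" if "0 < v" "E v \<le> E m" for v
  proof -
    have "(norm (\<tau> - z))\<^sup>2 * ((v - m)\<^sup>2 / v + 2 * m) \<le> (norm (\<tau> - z))\<^sup>2 * (2 * m)" using that(2) by (simp add: E_def)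
    then have "(v - m)\<^sup>2 / v + 2 * m \<le> 2 * m" using A mult_le_cancel_left_pos by blast
    then have "(v - m)\<^sup>2 \<le> 0" using that(1) by (simp add: divide_le_0_iff)
    then show ?thesis by simp
  qed
  have "hyp_proj \<tau> z = P m"
    unfolding hyp_proj_def
  proof (rule the_equality)
    show "P m \<in> diameter_to \<tau> \<and> (\<forall>u\<in>diameter_to \<tau>. hyp_dist z (P m) \<le> hyp_dist z u)"
    proof (intro conjI ballI)
      show "P m \<in> diameter_to \<tau>" by (rule Pdiam[OF m])
      fix u assume "u \<in> diameter_to \<tau>"
      then obtain v where "0 < v" "u = P v" using diam by blast
      then show "hyp_dist z (P m) \<le> hyp_dist z u" using le_iff[OF m] Em by simp
    qed
    fix w assume w: "w \<in> diameter_to \<tau> \<and> (\<forall>u\<in>diameter_to \<tau>. hyp_dist z w \<le> hyp_dist z u)"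
    then obtain v where v: "0 < v" "w = P v" using diam by blast
    then have "hyp_dist z (P v) \<le> hyp_dist z (P m)" using w Pdiam[OF m] by simp
    then show "w = P m" using le_iff[OF v(1) m] Eeq[OF v(1)] v by simp
  qed
  then show ?thesis by (simp add: P_def)
qed

text \<open>The condition 1 \<le> m puts the projection on the half of the diameter towards \<tau>;
  on the other half the logarithm would change sign.\<close>

lemma hyp_dist_hyp_proj:
  assumes \<tau>: "norm \<tau> = 1" and z: "z \<in> unit_disk"
  defines "m \<equiv> norm ((\<tau> + z) / (\<tau> - z))"
  assumes m: "1 \<le> m"
  shows "hyp_dist 0 (hyp_proj \<tau> z) = 1 / 2 * ln m"
proof -
  have "hyp_proj \<tau> z = of_real ((m - 1) / (m + 1)) * \<tau>"
    unfolding m_def by (rule hyp_proj_eq[OF \<tau> z]) (use m in \<open>unfold m_def, linarith\<close>)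
  then have "norm (pseudo_hyp 0 (hyp_proj \<tau> z)) = \<bar>(m - 1) / (m + 1)\<bar>"
    using \<tau> by (simp add: pseudo_hyp_def norm_mult del: of_real_divide)
  also have "\<dots> = (m - 1) / (m + 1)" using m by simp
  finally have n: "norm (pseudo_hyp 0 (hyp_proj \<tau> z)) = (m - 1) / (m + 1)" .
  have "1 + (m - 1) / (m + 1) = 2 * m / (m + 1)" "1 - (m - 1) / (m + 1) = 2 / (m + 1)"
    using m by (simp_all add: field_simps)
  then show ?thesis unfolding hyp_dist_def n using m by simp
qed

section \<open>Comparison of the two semigroups\<close>

lemma semigroup_in_unit_disk:
  assumes "holomorphic_semigroup \<phi>" "0 \<le> t" "z \<in> unit_disk"
  shows "\<phi> t z \<in> unit_disk"
proof -
  have "\<phi> t ` unit_disk \<subseteq> unit_disk" using assms(1,2) unfolding holomorphic_semigroup_def by blast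
  then show ?thesis using assms(3) by blast
qed

lemma norm_Cayley_orbit_at_top:
  assumes "holomorphic_semigroup \<phi>" "is_Denjoy_Wolff_point \<phi> \<tau>"
  shows "filterlim (\<lambda>t. norm ((\<tau> + \<phi> t 0) / (\<tau> - \<phi> t 0))) at_top at_top"
proof -
  have \<tau>: "norm \<tau> = 1" and lim: "((\<lambda>t. \<phi> t 0) \<longlongrightarrow> \<tau>) at_top"
    using assms(2) by (auto simp: is_Denjoy_Wolff_point_def)
  have "\<forall>\<^sub>F t in at_top. \<tau> - \<phi> t 0 \<noteq> 0"
    using eventually_ge_at_top[of 0]
  proof eventually_elim
    case (elim t)
    have "\<phi> t 0 \<in> unit_disk" by (rule semigroup_in_unit_disk[OF assms(1) elim]) simp
    then show ?case using \<tau> by auto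
  qed
  moreover have "((\<lambda>t. \<tau> - \<phi> t 0) \<longlongrightarrow> 0) at_top" using tendsto_diff[OF tendsto_const lim, of \<tau>] by simp
  ultimately have 1: "filterlim (\<lambda>t. \<tau> - \<phi> t 0) (at 0) at_top" by (simp add: filterlim_at)
  have 2: "((\<lambda>t. \<tau> + \<phi> t 0) \<longlongrightarrow> \<tau> + \<tau>) at_top" by (intro tendsto_intros lim)
  have "filterlim (\<lambda>t. (\<tau> + \<phi> t 0) / (\<tau> - \<phi> t 0)) at_infinity at_top"
    unfolding divide_inverse
    by (rule tendsto_mult_filterlim_at_infinity[OF 2 _ filterlim_compose[OF filterlim_inverse_at_infinity 1]])
      (use \<tau> in auto)
  then show ?thesis by (rule filterlim_at_infinity_imp_norm_at_top)
qed

theorem theorem1p4: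
  fixes \<phi> \<phi>' :: "real \<Rightarrow> complex \<Rightarrow> complex"
    and \<tau> \<tau>' :: complex and \<Omega> \<Omega>' :: "complex set"
  assumes "non_elliptic_semigroup \<phi>" and "non_elliptic_semigroup \<phi>'"
    and "is_Denjoy_Wolff_point \<phi> \<tau>" and "is_Denjoy_Wolff_point \<phi>' \<tau>'"
    and "is_Koenigs_domain \<phi> \<Omega>" and "is_Koenigs_domain \<phi>' \<Omega>'"
    and "\<Omega> \<subseteq> \<Omega>'"
  shows "Liminf at_top (\<lambda>t. ereal (orthogonal_speed \<phi> \<tau> t - orthogonal_speed \<phi>' \<tau>' t))
           \<ge> ereal (- ln 2)"
proof -
  have sg: "holomorphic_semigroup \<phi>" "holomorphic_semigroup \<phi>'"
    using assms(1,2) by (auto simp: non_elliptic_semigroup_def)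
  obtain h h' where h: "is_Koenigs_function \<phi> h" "\<Omega> = h ` unit_disk"
    and h': "is_Koenigs_function \<phi>' h'" "\<Omega>' = h' ` unit_disk"
    using assms(5,6) by (auto simp: is_Koenigs_domain_def)
  define k where "k = (\<lambda>w. h (\<tau> * ((w - 1) / (w + 1))))"
  define k' where "k' = (\<lambda>w. h' (\<tau>' * ((w - 1) / (w + 1))))"
  note K = Koenigs_half_plane[OF sg(1) assms(3) h(1), folded k_def]
  note K' = Koenigs_half_plane[OF sg(2) assms(4) h'(1), folded k'_def]
  interpret A: half_plane_Koenigs k by (rule K(1))
  interpret B: half_plane_Koenigs k' by (rule K'(1))
  have sub: "k ` right_half_plane \<subseteq> k' ` right_half_plane" using K(3) K'(3) h h' assms(7) by simp
  define W where "W = (\<lambda>t. norm ((\<tau> + \<phi> t 0) / (\<tau> - \<phi> t 0)))"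
  define W' where "W' = (\<lambda>t. norm ((\<tau>' + \<phi>' t 0) / (\<tau>' - \<phi>' t 0)))"
  have orb: "norm (A.orbit t) = W t" "norm (B.orbit t) = W' t" if "0 \<le> t" for t
    using K(2)[OF that] K'(2)[OF that] by (simp_all add: W_def W'_def)
  \<comment> \<open>The inclusion of the Koenigs domains makes this composition meaningful. It
    matches the two orbits at equal times, because each has Koenigs coordinate t at time t.\<close>
  define g where "g = B.k_inv \<circ> k"
  have g: "g holomorphic_on right_half_plane"
    unfolding g_def by (rule holomorphic_on_compose_gen[OF A.holo B.holo_k_inv sub])
  have g_pos: "0 < Re (g w)" if "0 < Re w" for w
  proof -
    have "k w \<in> k' ` right_half_plane" using sub that by blast
    then obtain v where "0 < Re v" "k w = k' v" by auto
    then show ?thesis using B.k_inv_k[of v] by (simp add: g_def)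
  qed
  have g_orbit: "g (A.orbit t) = B.orbit t" if "0 \<le> t" for t
    using A.k_orbit[OF that] by (simp add: g_def B.orbit_def)
  have g_1: "g 1 = 1" using g_orbit[of 0] by (simp add: A.orbit_0 B.orbit_0)
  have top: "filterlim W at_top at_top" "filterlim W' at_top at_top"
    unfolding W_def W'_def using norm_Cayley_orbit_at_top sg assms(3,4) by auto
  have ineq: "arctan (1 / W t) \<le> 4 * arctan (1 / W' t)" if t: "0 < t" "1 < W t" "1 < W' t" for t
  proof -
    have "pi / 2 - arctan (norm (A.orbit t)) \<le> 4 * arctan (1 / W' t)"
    proof (rule A.orbit_comparison[OF t(1) g g_pos g_1 t(3)])
      fix s assume s: "t \<le> s"
      then show "W' t \<le> norm (g (A.orbit s))"
        using B.norm_orbit_mono[of t s] g_orbit[of s] orb(2)[of t] t by simp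
    qed
    then show ?thesis using orb(1)[of t] arctan_inverse[of "W t"] t by (simp add: inverse_eq_divide)
  qed
  have speed: "orthogonal_speed \<phi> \<tau> t = 1 / 2 * ln (W t)" if "0 < t" "1 < W t" for t
    unfolding orthogonal_speed_def W_def
    by (rule hyp_dist_hyp_proj)
       (use that semigroup_in_unit_disk[OF sg(1), of t 0] assms(3) in \<open>simp_all add: W_def is_Denjoy_Wolff_point_def\<close>)
  have speed': "orthogonal_speed \<phi>' \<tau>' t = 1 / 2 * ln (W' t)" if "0 < t" "1 < W' t" for t
    unfolding orthogonal_speed_def W'_def
    by (rule hyp_dist_hyp_proj)
       (use that semigroup_in_unit_disk[OF sg(2), of t 0] assms(4) in \<open>simp_all add: W'_def is_Denjoy_Wolff_point_def\<close>)
  \<comment> \<open>With a = W t and b = W' t, the bounds arctan (1/a) \<ge> (1/a) / (1 + 1/a^2) and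
    arctan (1/b) \<le> 1/b turn the arctangent inequality into b \<le> 4 a (1 + 1/a^2). Half the
    logarithm gives ln 2 and an error that vanishes as W tends to infinity.\<close>
  define L where "L = (\<lambda>t. - (1 / 2) * ln (1 + (inverse (W t))\<^sup>2) - ln 2)"
  have "\<forall>\<^sub>F t in at_top. 1 < W t" "\<forall>\<^sub>F t in at_top. 1 < W' t"
    using top by (simp_all add: filterlim_at_top_dense)
  with eventually_gt_at_top[of 0] have ev: "\<forall>\<^sub>F t in at_top. ereal (L t) \<le> ereal (orthogonal_speed \<phi> \<tau> t - orthogonal_speed \<phi>' \<tau>' t)"
  proof eventually_elim
    case (elim t)
    define a b where "a = W t" and "b = W' t"
    have a: "1 < a" and b: "1 < b" using elim by (auto simp: a_def b_def)
    define c where "c = 1 + (inverse a)\<^sup>2"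
    have c: "1 \<le> c" by (simp add: c_def)
    have "1 / a / c \<le> arctan (1 / a)"
      using arctan_diff_ge[of 0 "1 / a"] a by (simp add: c_def inverse_eq_divide)
    also have "\<dots> \<le> 4 * arctan (1 / b)" using ineq elim by (simp add: a_def b_def)
    also have "\<dots> \<le> 4 * (1 / b)" using b by (intro mult_left_mono arctan_le_self) auto
    finally have "b \<le> 4 * a * c" using a b c by (simp add: field_simps)
    then have "ln b \<le> ln (4 * a * c)" using a b c by (intro ln_mono) auto
    also have "\<dots> = ln 4 + ln a + ln c" using a c by (simp add: ln_mult)
    also have "ln (4::real) = 2 * ln 2" using ln_realpow[of 2 2] by simp
    finally have "- (1 / 2) * ln c - ln 2 \<le> 1 / 2 * ln a - 1 / 2 * ln b" by simp
    moreover have "orthogonal_speed \<phi> \<tau> t = 1 / 2 * ln a" "orthogonal_speed \<phi>' \<tau>' t = 1 / 2 * ln b"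
      using speed[of t] speed'[of t] elim by (simp_all add: a_def b_def)
    ultimately show ?case by (simp add: L_def a_def b_def c_def)
  qed
  have "((\<lambda>t. inverse (W t)) \<longlongrightarrow> 0) at_top"
    by (rule tendsto_inverse_0_at_top[OF top(1)])
  then have "(L \<longlongrightarrow> - (1 / 2) * ln (1 + 0\<^sup>2) - ln 2) at_top"
    unfolding L_def by (intro tendsto_intros) auto
  then have "((\<lambda>t. ereal (L t)) \<longlongrightarrow> ereal (- ln 2)) at_top" by simp
  then have "ereal (- ln 2) = Liminf at_top (\<lambda>t. ereal (L t))"
    by (intro lim_imp_Liminf[symmetric]) auto
  also have "\<dots> \<le> Liminf at_top (\<lambda>t. ereal (orthogonal_speed \<phi> \<tau> t - orthogonal_speed \<phi>' \<tau>' t))"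
    by (rule Liminf_mono[OF ev])
  finally show ?thesis .
qed

end
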